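(* Let $\Phi_1$ and $\Phi_2$ be two $\mathcal{C}^1$ convex growth functions with $\Phi_2\in\mathscr{U}$. Assume that $\Phi_1$ satisfies the $\nabla_2$-condition and that $t\mapsto \frac{\Phi_2(t)}{\Phi_1(t)}$ is nondecreasing. Let $\mu$ be a positive Borel measure on $\mathbb{C}_+$. Then the following assertions are equivalent. (a) $\mu$ is a $\Phi_2\circ\Phi_1^{-1}$-Carleson measure, i.e. there is $C>0$ such that for every finite interval $I\subset\mathbb{R}$, $\mu(Q_I)\le \dfrac{C}{\Phi_2\circ\Phi_1^{-1}\left(\frac{1}{|I|}\right)}$. (b) There exists a constant $C>0$ such that $$\sup_{z=x+iy\in \mathbb{C}_+}\int_{\mathbb{C}_+}\Phi_2\left(\Phi_1^{-1}\left(\frac{1}{y}\right)\frac{y^2}{|z-\bar{w}|^2}\right)d\mu(w)\le C<\infty.$$ (c) There exists a constant $K>0$ such that for any $f\in H^{\Phi_1}(\mathbb{C}_+)$, $f\neq 0$, $$\int_{\mathbb{C}_+}\Phi_2\left(\frac{|f(z)|}{K\|f\|_{H^{\Phi_1}}^{lux}}\right)d\mu(z)<\infty.$$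
   Context: $\mathbb{C}_+=\{x+iy: y>0\}$. A growth function is a continuous nondecreasing function $\Phi$ from $[0,\infty)$ onto $[0,\infty)$ (so $\Phi(0)=0$); $\Phi^{-1}$ denotes its inverse. $\Phi$ is of upper type $q$ if there is $C>0$ with $\Phi(st)\le Ct^q\Phi(s)$ for all $s>0$, $t\ge1$; $\mathscr{U}^q$ is the set of growth functions of upper type $q$ ($q\ge1$) such that $t\mapsto\Phi(t)/t$ is nondecreasing, and $\mathscr{U}=\bigcup_{q\ge1}\mathscr{U}^q$. $\Phi$ satisfies the $\Delta_2$-condition if $\Phi(2t)\le K\Phi(t)$ for some $K>1$ and all $t\ge0$; a convex $\Phi$ satisfies the $\nabla_2$-condition if both $\Phi$ and its complementary function $\Psi(s)=\sup_{t\ge0}\{ts-\Phi(t)\}$ satisfy the $\Delta_2$-condition. For an interval $I\subset\mathbb{R}$, the Carleson square is $Q_I=\{x+iy: x\in I, 0<y<|I|\}$. For a growth function $\Phi$, $\|g\|_{L^\Phi}^{lux}=\inf\{\lambda>0:\int_{\mathbb{R}}\Phi(|g(x)|/\lambda)dx\le1\}$, and the Hardy–Orlicz space $H^\Phi(\mathbb{C}_+)$ is the space of holomorphic $f$ on $\mathbb{C}_+$ with $\|f\|_{H^\Phi}^{lux}:=\sup_{y>0}\|f(\cdot+iy)\|_{L^\Phi}^{lux}<\infty$. *)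

theory Defs
  imports "HOL-Analysis.Analysis"
begin

definition growth_function :: "(real \<Rightarrow> real) \<Rightarrow> bool" where
  "growth_function \<Phi> \<longleftrightarrow> continuous_on {0..} \<Phi> \<and> mono_on {0..} \<Phi> \<and> \<Phi> ` {0..} = {0..}"

text \<open>Inverse of a growth function (on [0,oo)); only used at positive arguments,
  where a convex growth function is strictly increasing, so it is unambiguous.\<close>
definition ginv :: "(real \<Rightarrow> real) \<Rightarrow> real \<Rightarrow> real" where
  "ginv \<Phi> s = inv_into {0..} \<Phi> s"

definition C1_on_nonneg :: "(real \<Rightarrow> real) \<Rightarrow> bool" where
  "C1_on_nonneg \<Phi> \<longleftrightarrow> (\<exists>\<Phi>'. continuous_on {0..} \<Phi>' \<and>
      (\<forall>t\<ge>0. (\<Phi> has_real_derivative \<Phi>' t) (at t within {0..})))"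

definition upper_type :: "real \<Rightarrow> (real \<Rightarrow> real) \<Rightarrow> bool" where
  "upper_type q \<Phi> \<longleftrightarrow> (\<exists>C>0. \<forall>s>0. \<forall>t\<ge>1. \<Phi> (s * t) \<le> C * t powr q * \<Phi> s)"

definition class_Uq :: "real \<Rightarrow> (real \<Rightarrow> real) set" where
  "class_Uq q = {\<Phi>. q \<ge> 1 \<and> growth_function \<Phi> \<and> upper_type q \<Phi> \<and>
                     mono_on {0<..} (\<lambda>t. \<Phi> t / t)}"

definition class_U :: "(real \<Rightarrow> real) set" where
  "class_U = (\<Union>q\<in>{1..}. class_Uq q)"

definition Delta2 :: "(real \<Rightarrow> real) \<Rightarrow> bool" where
  "Delta2 \<Phi> \<longleftrightarrow> (\<exists>K>1. \<forall>t\<ge>0. \<Phi> (2 * t) \<le> K * \<Phi> t)"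

text \<open>Complementary function, possibly infinite, hence extended-real valued.\<close>
definition compl_fun :: "(real \<Rightarrow> real) \<Rightarrow> real \<Rightarrow> ereal" where
  "compl_fun \<Phi> s = (SUP t\<in>{0::real..}. ereal (t * s - \<Phi> t))"

definition Delta2_ereal :: "(real \<Rightarrow> ereal) \<Rightarrow> bool" where
  "Delta2_ereal \<Psi> \<longleftrightarrow> (\<exists>K>1. \<forall>s\<ge>0. \<Psi> (2 * s) \<le> ereal K * \<Psi> s)"

definition Nabla2 :: "(real \<Rightarrow> real) \<Rightarrow> bool" where
  "Nabla2 \<Phi> \<longleftrightarrow> convex_on {0..} \<Phi> \<and> Delta2 \<Phi> \<and> Delta2_ereal (compl_fun \<Phi>)"

definition upper_half_plane :: "complex set" ("\<complex>\<^sub>+") where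
  "\<complex>\<^sub>+ = {z. Im z > 0}"

text \<open>Carleson square over an interval I with endpoints a < b (so |I| = b - a).\<close>
definition carleson_square :: "real set \<Rightarrow> real \<Rightarrow> complex set" where
  "carleson_square I len = {z. Re z \<in> I \<and> 0 < Im z \<and> Im z < len}"

text \<open>Luxemburg (quasi-)norm; extended-real valued (infinite if no admissible lambda).\<close>
definition lux_norm :: "(real \<Rightarrow> real) \<Rightarrow> (real \<Rightarrow> complex) \<Rightarrow> ereal" where
  "lux_norm \<Phi> g = Inf {ereal l | l. l > 0 \<and>
       (\<integral>\<^sup>+ x. ennreal (\<Phi> (cmod (g x) / l)) \<partial>lborel) \<le> 1}"

definition hardy_norm :: "(real \<Rightarrow> real) \<Rightarrow> (complex \<Rightarrow> complex) \<Rightarrow> ereal" where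
  "hardy_norm \<Phi> f = (SUP y\<in>{0<..}. lux_norm \<Phi> (\<lambda>x. f (Complex x y)))"

definition hardy_orlicz :: "(real \<Rightarrow> real) \<Rightarrow> (complex \<Rightarrow> complex) set" where
  "hardy_orlicz \<Phi> = {f. f holomorphic_on \<complex>\<^sub>+ \<and> hardy_norm \<Phi> f < \<infinity>}"

end

theory Submission
  imports Defs "HOL-Complex_Analysis.Complex_Analysis"
begin

text \<open>
  For \<open>z\<close> at height \<open>\<bar>I\<bar>\<close> above the midpoint of \<open>I\<close>, the argument of \<open>\<Phi>\<^sub>2\<close> in (b) is comparable to
  \<open>\<Phi>\<^sub>1\<inverse>(1/\<bar>I\<bar>)\<close> on \<open>Q\<^sub>I\<close>, and the contributions of the squares over the dyadic dilates of \<open>I\<close>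
  decay geometrically; this gives the equivalence of (a) and (b).

  For (a) to (c), a function in the unit ball is dominated, after an upward shift, by the Poisson
  integral of its boundary modulus \<open>g\<close>. If \<open>\<bar>F\<bar>\<close> is large at a point, then \<open>g\<close>, truncated from below at a
  comparable level \<open>L\<close>, has a large average over an interval below that point, and the Vitali covering
  lemma turns the Carleson condition into
  \<open>\<mu>(\<bar>F\<bar> > 16 L) \<le> C \<Phi>\<^sub>1(L) / (L \<Phi>\<^sub>2(L)) \<integral>\<^bsub>g > L\<^esub> g\<close>. The \<open>\<nabla>\<^sub>2\<close>-condition amounts to
  \<open>2 a \<Phi>\<^sub>1(u) \<le> \<Phi>\<^sub>1(a u)\<close> for some \<open>a > 1\<close>, so summing over the levels \<open>L = a\<^sup>j\<close> costs only a
  geometric series.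

  For (c) to (a), the functions \<open>\<Phi>\<^sub>1\<inverse>(1/l) i l / (z - c + i l)\<close> have positive real part and
  uniformly bounded norm. If the Carleson condition failed with constants growing geometrically along
  a sequence of intervals, the sum of the associated functions with weights \<open>2\<^sup>-\<^sup>n\<close> would violate (c);
  positivity of the real parts excludes cancellation.
\<close>

section \<open>Convex growth functions\<close>

text \<open>A convex growth function such as \<open>max 0 (t - 1)\<close> vanishes near 0.
  Positivity is therefore a separate assumption; it yields strict monotonicity, so that
  \<open>ginv\<close> is a genuine inverse. It is later derived from doubling.\<close>

locale convex_growth =
  fixes \<Phi> :: "real \<Rightarrow> real"
  assumes growth: "growth_function \<Phi>"
    and convex: "convex_on {0..} \<Phi>"
    and pos: "\<And>t. t > 0 \<Longrightarrow> \<Phi> t > 0"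
begin

lemma mono: "0 \<le> s \<Longrightarrow> s \<le> t \<Longrightarrow> \<Phi> s \<le> \<Phi> t"
  using growth by (auto simp: growth_function_def mono_on_def)

lemma nonneg: "0 \<le> t \<Longrightarrow> 0 \<le> \<Phi> t"
  using growth by (auto simp: growth_function_def)

lemma zero [simp]: "\<Phi> 0 = 0"
proof -
  have "0 \<in> \<Phi> ` {0..}"
    using growth by (auto simp: growth_function_def)
  then obtain t where "t \<ge> 0" "\<Phi> t = 0"
    by force
  with mono[of 0 t] nonneg[of 0] show ?thesis
    by simp
qed

lemma continuous: "continuous_on {0..} \<Phi>"
  using growth by (simp add: growth_function_def)

lemma scale_le:
  assumes "0 \<le> c" "c \<le> 1" "0 \<le> t"
  shows "\<Phi> (c * t) \<le> c * \<Phi> t"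
  using convex_onD[OF convex, of c 0 t] assms by simp

text \<open>Slopes of chords through the origin increase for a convex function vanishing at
  0.\<close>

lemma ratio_le:
  assumes "0 < s" "s \<le> t"
  shows "\<Phi> s * t \<le> \<Phi> t * s"
  using scale_le[of "s / t" t] assms by (simp add: field_simps)

lemma strict: 
  assumes "0 \<le> s" "s < t"
  shows "\<Phi> s < \<Phi> t"
proof (cases "s = 0")
  case False
  then have "\<Phi> s * t \<le> \<Phi> t * s"
    using ratio_le assms by simp
  also have "\<dots> < \<Phi> t * t"
    using assms pos[of t] by (intro mult_strict_left_mono) auto
  finally show ?thesis
    using assms by (simp add: mult_less_cancel_right)
qed (use assms pos in auto)

lemma less_iff: "0 \<le> s \<Longrightarrow> 0 \<le> t \<Longrightarrow> \<Phi> s < \<Phi> t \<longleftrightarrow> s < t"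
  using strict[of s t] mono[of t s] by (cases "s < t") auto

lemma
  assumes "0 \<le> s"
  shows ginv_nonneg: "0 \<le> ginv \<Phi> s" and ginv_right [simp]: "\<Phi> (ginv \<Phi> s) = s"
proof -
  have "s \<in> \<Phi> ` {0..}"
    using growth assms by (simp add: growth_function_def)
  then show "0 \<le> ginv \<Phi> s" "\<Phi> (ginv \<Phi> s) = s"
    unfolding ginv_def using inv_into_into[of s \<Phi> "{0..}"] by (auto simp: f_inv_into_f)
qed

lemma ginv_le_iff:
  assumes "0 \<le> s" "0 \<le> t"
  shows "ginv \<Phi> s \<le> t \<longleftrightarrow> s \<le> \<Phi> t"
  using less_iff[of t "ginv \<Phi> s"] ginv_nonneg ginv_right assms by (metis not_le)

lemma le_ginv_iff:
  assumes "0 \<le> s" "0 \<le> t"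
  shows "t \<le> ginv \<Phi> s \<longleftrightarrow> \<Phi> t \<le> s"
  using less_iff[of "ginv \<Phi> s" t] ginv_nonneg ginv_right assms by (metis not_le)

lemma ginv_mono: "0 \<le> s \<Longrightarrow> s \<le> t \<Longrightarrow> ginv \<Phi> s \<le> ginv \<Phi> t"
  by (simp add: ginv_le_iff ginv_nonneg)

lemma ginv_pos:
  assumes "0 < s" 
  shows "0 < ginv \<Phi> s"
proof -
  have "ginv \<Phi> s \<noteq> 0"
    using ginv_right[of s] assms by (intro notI) simp
  then show ?thesis
    using ginv_nonneg[of s] assms by simp
qed

text \<open>The inverse of a convex function is concave, and it vanishes at 0. This is how a change
  of length scale passes through \<open>ginv\<close>.\<close>

lemma scale_ginv_le:
  assumes "0 \<le> c" "c \<le> 1" "0 \<le> s"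
  shows "c * ginv \<Phi> s \<le> ginv \<Phi> (c * s)"
  using assms scale_le[of c "ginv \<Phi> s"] by (simp add: le_ginv_iff ginv_nonneg)

lemma measurable_comp [measurable]:
  assumes [measurable]: "g \<in> borel_measurable M" and "\<And>x. 0 \<le> g x"
  shows "(\<lambda>x. \<Phi> (g x)) \<in> borel_measurable M"
proof -
  \<comment> \<open>Continuity is given on the half line; composition with \<open>max 0\<close>
    extends it to all reals, where it implies Borel measurability.\<close>
  have "continuous_on UNIV (\<lambda>t. \<Phi> (max 0 t))"
    by (intro continuous_on_compose2[OF continuous] continuous_intros) auto
  then have "(\<lambda>t. \<Phi> (max 0 t)) \<in> borel_measurable borel"
    by (rule borel_measurable_continuous_onI)
  from measurable_compose[OF assms(1) this] show ?thesis
    using assms(2) by (simp add: max_absorb2)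
qed

end

section \<open>Doubling and dilation inequalities\<close>

lemma upper_type_doubling:
  assumes "upper_type q \<Phi>"
  obtains D where "D > 0" "\<And>s. s > 0 \<Longrightarrow> \<Phi> (2 * s) \<le> D * \<Phi> s"
proof -
  obtain C where "C > 0" and C: "\<And>s t. s > 0 \<Longrightarrow> t \<ge> 1 \<Longrightarrow> \<Phi> (s * t) \<le> C * t powr q * \<Phi> s"
    using assms by (auto simp: upper_type_def)
  show thesis
    using C[of _ 2] \<open>C > 0\<close> by (intro that[of "C * 2 powr q"]) (auto simp: mult.commute)
qed

text \<open>A zero at \<open>t\<close> propagates to all points \<open>2 ^ n * t\<close>, and
  monotonicity spreads it over the whole half line. This contradicts surjectivity onto
  \<open>{0..}\<close>.\<close>

lemma doubling_pos:
  assumes growth: "growth_function \<Phi>" and dbl: "\<And>s. s > 0 \<Longrightarrow> \<Phi> (2 * s) \<le> D * \<Phi> s" and "t > 0"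
  shows "\<Phi> t > 0"
proof (rule ccontr)
  have nonneg: "\<Phi> s \<ge> 0" if "s \<ge> 0" for s
    using growth that by (auto simp: growth_function_def)
  assume "\<not> \<Phi> t > 0"
  then have "\<Phi> t = 0"
    using nonneg[of t] \<open>t > 0\<close> by simp
  have *: "\<Phi> (2 ^ n * t) = 0" for n
  proof (induction n)
    case (Suc n)
    have "\<Phi> (2 * (2 ^ n * t)) \<le> D * \<Phi> (2 ^ n * t)"
      using \<open>t > 0\<close> by (intro dbl) simp
    with Suc nonneg[of "2 * (2 ^ n * t)"] \<open>t > 0\<close> show ?case
      by (simp add: mult.assoc)
  qed (simp add: \<open>\<Phi> t = 0\<close>)
  have "1 \<in> \<Phi> ` {0..}"
    using growth by (simp add: growth_function_def)
  then obtain u where u: "u \<ge> 0" "\<Phi> u = 1"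
    by force
  obtain n where "u / t < 2 ^ n"
    using real_arch_pow[of 2 "u / t"] by auto
  then have "u \<le> 2 ^ n * t"
    using \<open>t > 0\<close> by (simp add: field_simps)
  then have "\<Phi> u \<le> \<Phi> (2 ^ n * t)"
    using growth u mono_onD[of "{0..}" \<Phi> u "2 ^ n * t"] by (auto simp: growth_function_def)
  with * u show False
    by simp
qed

text \<open>The doubling of the complementary function is read at the slope of \<open>\<Phi>\<close>
  at \<open>u\<close>, where the supremum is attained at \<open>u\<close> itself. Testing the
  supremum for the doubled slope at \<open>K / 2 * u\<close> makes the linear terms cancel and
  leaves \<open>K * \<Phi> u \<le> \<Phi> (K / 2 * u)\<close>, so \<open>a = K / 2\<close>.\<close>

lemma (in convex_growth) Nabla2_dilation:
  assumes C1: "C1_on_nonneg \<Phi>" and nabla: "Nabla2 \<Phi>"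
  obtains a where "a > 1" "\<And>u. u \<ge> 0 \<Longrightarrow> 2 * a * \<Phi> u \<le> \<Phi> (a * u)"
proof -
  obtain \<Phi>' where deriv: "\<And>t. t \<ge> 0 \<Longrightarrow> (\<Phi> has_real_derivative \<Phi>' t) (at t within {0..})"
    using C1 by (auto simp: C1_on_nonneg_def)
  obtain K where "K > 1" and K: "\<And>s. s \<ge> 0 \<Longrightarrow> compl_fun \<Phi> (2 * s) \<le> ereal K * compl_fun \<Phi> s"
    using nabla by (auto simp: Nabla2_def Delta2_ereal_def)
  have *: "K * \<Phi> u \<le> \<Phi> (K / 2 * u)" if "u > 0" for u
  proof -
    define s where "s = \<Phi>' u"
    have tangent: "\<Phi> v \<ge> \<Phi> u + s * (v - u)" if "v \<ge> 0" for v
      using convex_on_imp_above_tangent[OF convex, of u v s] deriv[of u] \<open>u > 0\<close> that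
      unfolding s_def by (simp add: interior_real_atLeast)
    have "s \<ge> 0"
    proof (rule ccontr)
      assume "\<not> s \<ge> 0"
      then have "s * (0 - u) > 0"
        using \<open>u > 0\<close> by (simp add: mult_neg_pos)
      with tangent[of 0] pos[OF \<open>u > 0\<close>] show False
        by simp
    qed
    \<comment> \<open>equality case of Young's inequality at the slope \<open>s = \<Phi>'(u)\<close>\<close>
    have "compl_fun \<Phi> s \<le> ereal (s * u - \<Phi> u)"
      unfolding compl_fun_def using tangent by (intro SUP_least) (auto simp: algebra_simps)
    then have "ereal K * compl_fun \<Phi> s \<le> ereal K * ereal (s * u - \<Phi> u)"
      using \<open>K > 1\<close> by (intro ereal_mult_left_mono) auto
    moreover have "ereal (K / 2 * u * (2 * s) - \<Phi> (K / 2 * u)) \<le> compl_fun \<Phi> (2 * s)"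
      unfolding compl_fun_def using \<open>u > 0\<close> \<open>K > 1\<close> by (intro SUP_upper) auto
    ultimately have "ereal (K / 2 * u * (2 * s) - \<Phi> (K / 2 * u)) \<le> ereal (K * (s * u - \<Phi> u))"
      using K[OF \<open>s \<ge> 0\<close>] by (metis order_trans times_ereal.simps(1))
    then show ?thesis
      by (simp add: algebra_simps)
  qed
  \<comment> \<open>If \<open>K \<le> 2\<close>, the inequality at \<open>u = 1\<close> would give
    \<open>K * \<Phi> 1 \<le> \<Phi> 1\<close>. Hence the dilation factor \<open>K / 2\<close>
    exceeds 1.\<close>
  have "K > 2"
  proof (rule ccontr)
    assume "\<not> K > 2"
    then have "\<Phi> (K / 2 * 1) \<le> \<Phi> 1"
      using \<open>K > 1\<close> by (intro mono) auto
    moreover have "\<Phi> 1 < K * \<Phi> 1"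
      using \<open>K > 1\<close> pos[of 1] by simp
    ultimately show False
      using *[of 1] by simp
  qed
  show thesis
  proof (rule that[of "K / 2"])
    fix u :: real assume "u \<ge> 0"
    then show "2 * (K / 2) * \<Phi> u \<le> \<Phi> (K / 2 * u)"
      using *[of u] by (cases "u = 0") auto
  qed (use \<open>K > 2\<close> in simp)
qed

lemma suminf_ennreal_half_powers:
  assumes "c \<ge> 0"
  shows "(\<Sum>n. ennreal (c * (1 / 2) ^ n)) = ennreal (c * 2)"
proof -
  have "(\<lambda>n. c * (1 / 2) ^ n) sums (c * 2)"
    using geometric_sums[of "1 / 2 :: real"] by (intro sums_mult) simp
  then show ?thesis
    using assms by (intro suminf_ennreal_eq) auto
qed

text \<open>Countable sums commute with the integral, so \<open>M\<close> need not be sigma-finite.\<close>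
lemma nn_integral_le_cover:
  fixes c :: "'i \<Rightarrow> ennreal"
  assumes "countable I" and S: "\<And>k. k \<in> I \<Longrightarrow> S k \<in> sets M"
    and cover: "\<And>x. x \<in> space M \<Longrightarrow> g x > 0 \<Longrightarrow> \<exists>k\<in>I. x \<in> S k \<and> g x \<le> c k"
  shows "(\<integral>\<^sup>+x. g x \<partial>M) \<le> (\<integral>\<^sup>+k. c k * emeasure M (S k) \<partial>count_space I)"
proof -
  have "(\<integral>\<^sup>+x. g x \<partial>M) \<le> (\<integral>\<^sup>+x. (\<integral>\<^sup>+k. c k * indicator (S k) x \<partial>count_space I) \<partial>M)"
  proof (rule nn_integral_mono)
    fix x assume x: "x \<in> space M"
    show "g x \<le> (\<integral>\<^sup>+k. c k * indicator (S k) x \<partial>count_space I)"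
    proof (cases "g x > 0")
      case True
      with cover x obtain k where k: "k \<in> I" "x \<in> S k" "g x \<le> c k"
        by blast
      then have "g x \<le> c k * indicator (S k) x"
        by simp
      also have "\<dots> \<le> (\<integral>\<^sup>+k. c k * indicator (S k) x \<partial>count_space I)"
        by (rule nn_integral_ge_point) (use k in simp)
      finally show ?thesis .
    qed (simp add: not_less)
  qed
  also have "\<dots> = (\<integral>\<^sup>+k. (\<integral>\<^sup>+x. c k * indicator (S k) x \<partial>M) \<partial>count_space I)"
    using S \<open>countable I\<close> by (intro nn_integral_count_space_nn_integral) auto
  also have "\<dots> = (\<integral>\<^sup>+k. c k * emeasure M (S k) \<partial>count_space I)"
    using S by (intro nn_integral_cong) (simp add: nn_integral_cmult_indicator)
  finally show ?thesis .
qed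

section \<open>Carleson squares and the testing condition\<close>

text \<open>The base differs from an open interval by at most its two end points, so it is a Borel
  set.\<close>

lemma carleson_square_measurable:
  assumes "a < b" "{a<..<b} \<subseteq> I" "I \<subseteq> {a..b}"
  shows "carleson_square I l \<in> sets borel"
proof -
  have "I = {a<..<b} \<union> (I \<inter> {a, b})"
    using assms(2,3) by (auto simp: set_eq_iff subset_iff order.order_iff_strict)
  moreover have "I \<inter> {a, b} \<in> sets borel"
    by (intro borel_closed finite_imp_closed) auto
  ultimately have [measurable]: "I \<in> sets borel"
    by (metis sets.Un borel_open open_greaterThanLessThan)
  have "carleson_square I l = {z \<in> space borel. Re z \<in> I \<and> 0 < Im z \<and> Im z < l}"
    by (auto simp: carleson_square_def)
  then show ?thesis
    by simp
qed

lemma sets_upper_half_plane [measurable]: "\<complex>\<^sub>+ \<in> sets borel"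
  unfolding upper_half_plane_def by (intro borel_open open_halfspace_Im_gt)

text \<open>The upper type of \<open>\<Phi>2\<close> enters through the doubling constant
  \<open>D\<close>: a factor at most \<open>2 ^ n\<close> in the argument costs
  \<open>D ^ n\<close>.\<close>

locale growth_pair =
  \<Phi>1: convex_growth \<Phi>1 + \<Phi>2: convex_growth \<Phi>2 for \<Phi>1 \<Phi>2 :: "real \<Rightarrow> real" +
  fixes D :: real
  assumes D_pos: "D > 0"
    and doubling: "\<And>s. s > 0 \<Longrightarrow> \<Phi>2 (2 * s) \<le> D * \<Phi>2 s"
    and ratio: "mono_on {0<..} (\<lambda>t. \<Phi>2 t / \<Phi>1 t)"
begin

lemma doubling_power: "0 \<le> s \<Longrightarrow> \<Phi>2 (2 ^ n * s) \<le> D ^ n * \<Phi>2 s"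
proof (induction n)
  case (Suc n)
  show ?case
  proof (cases "s = 0")
    case False
    then have "\<Phi>2 (2 * (2 ^ n * s)) \<le> D * \<Phi>2 (2 ^ n * s)"
      using Suc by (intro doubling) auto
    also have "\<dots> \<le> D * (D ^ n * \<Phi>2 s)"
      using Suc D_pos by (intro mult_left_mono) auto
    finally show ?thesis
      by (simp add: mult.assoc)
  qed simp
qed simp

definition carl :: "real \<Rightarrow> real" where
  "carl l = 1 / \<Phi>2 (ginv \<Phi>1 (1 / l))"

lemma carl_pos: "l > 0 \<Longrightarrow> carl l > 0"
  unfolding carl_def by (simp add: \<Phi>1.ginv_pos \<Phi>2.pos)

text \<open>With \<open>\<Phi>1 u = 1 / s\<close> and \<open>\<Phi>1 v = 1 / r\<close>, this is the
  monotonicity of \<open>\<Phi>2 / \<Phi>1\<close> between \<open>u\<close> and \<open>v\<close>. It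
  makes the Carleson bound of short intervals at most linear in their length, so that the bounds can
  be summed over disjoint intervals.\<close>

lemma carl_scale:
  assumes "0 < r" "r \<le> s"
  shows "carl r \<le> r / s * carl s"
proof -
  define u v where "u = ginv \<Phi>1 (1 / s)" and "v = ginv \<Phi>1 (1 / r)"
  have "0 < u"
    unfolding u_def using assms by (intro \<Phi>1.ginv_pos) auto
  have "u \<le> v"
    unfolding u_def v_def using assms by (intro \<Phi>1.ginv_mono) (auto simp: field_simps)
  have "\<Phi>1 u = 1 / s" "\<Phi>1 v = 1 / r"
    unfolding u_def v_def using assms by auto
  moreover have "\<Phi>2 u / \<Phi>1 u \<le> \<Phi>2 v / \<Phi>1 v"
    using mono_onD[OF ratio, of u v] \<open>0 < u\<close> \<open>u \<le> v\<close> by simp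
  ultimately have "\<Phi>2 u * s \<le> \<Phi>2 v * r"
    by simp
  moreover have "\<Phi>2 u > 0" "\<Phi>2 v > 0"
    using \<Phi>2.pos \<open>0 < u\<close> \<open>u \<le> v\<close> by auto
  ultimately show ?thesis
    using assms unfolding carl_def u_def[symmetric] v_def[symmetric] by (simp add: field_simps)
qed

definition kernel :: "complex \<Rightarrow> complex \<Rightarrow> real" where
  "kernel z w = ginv \<Phi>1 (1 / Im z) * (Im z)\<^sup>2 / (cmod (z - cnj w))\<^sup>2"

lemma kernel_nonneg: "Im z > 0 \<Longrightarrow> kernel z w \<ge> 0"
  unfolding kernel_def by (simp add: \<Phi>1.ginv_nonneg)

end

locale growth_measure = growth_pair +
  fixes \<mu> :: "complex measure"
  assumes sets_eq [measurable_cong]: "sets \<mu> = sets borel"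
begin

definition carleson :: "real \<Rightarrow> bool" where
  "carleson C \<longleftrightarrow> (\<forall>a b I. a < b \<and> {a<..<b} \<subseteq> I \<and> I \<subseteq> {a..b} \<longrightarrow>
     emeasure \<mu> (carleson_square I (b - a)) \<le> ennreal (C / \<Phi>2 (ginv \<Phi>1 (1 / (b - a)))))"

definition testing :: "real \<Rightarrow> bool" where
  "testing C \<longleftrightarrow> (\<forall>z\<in>\<complex>\<^sub>+. (\<integral>\<^sup>+ w\<in>\<complex>\<^sub>+. ennreal (\<Phi>2 (kernel z w)) \<partial>\<mu>) \<le> ennreal C)"

lemma square_in_sets [measurable]:
  "a < b \<Longrightarrow> carleson_square {a<..<b} l \<in> sets \<mu>"
  using carleson_square_measurable[of a b "{a<..<b}"] sets_eq by (auto simp: subset_iff)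

lemma carlesonD:
  assumes "carleson C" "0 < r"
  shows "emeasure \<mu> (carleson_square {x - r<..<x + r} (2 * r)) \<le> ennreal (C * carl (2 * r))"
proof -
  have "emeasure \<mu> (carleson_square {x - r<..<x + r} ((x + r) - (x - r)))
      \<le> ennreal (C / \<Phi>2 (ginv \<Phi>1 (1 / ((x + r) - (x - r)))))"
    using assms by (intro carleson_def[THEN iffD1, rule_format]) auto
  then show ?thesis
    by (simp add: carl_def algebra_simps)
qed

section \<open>Equivalence of (a) and (b)\<close>

lemma testing_imp_carleson:
  assumes "testing C" "C > 0"
  shows "\<exists>C'>0. carleson C'"
proof (intro exI conjI)
  show "D ^ 3 * C > 0"
    using \<open>C > 0\<close> D_pos by simp
  show "carleson (D ^ 3 * C)"
    unfolding carleson_def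
  proof (intro allI impI, elim conjE)
    fix a b and I :: "real set"
    assume "a < b" and I: "{a<..<b} \<subseteq> I" "I \<subseteq> {a..b}"
    define l where "l = b - a"
    define s where "s = ginv \<Phi>1 (1 / l)"
    define z where "z = Complex ((a + b) / 2) l"
    have "l > 0"
      using \<open>a < b\<close> by (simp add: l_def)
    then have "s > 0" "\<Phi>2 s > 0"
      unfolding s_def by (simp_all add: \<Phi>1.ginv_pos \<Phi>2.pos)
    have [measurable]: "carleson_square I l \<in> sets \<mu>"
      using carleson_square_measurable[OF \<open>a < b\<close> I] sets_eq by simp
    \<comment> \<open>On the square, the squared distance is at most
      \<open>l\<^sup>2 + (2 * l)\<^sup>2\<close>, rounded up to \<open>8 * l\<^sup>2\<close>. Since
      8 is \<open>2 ^ 3\<close>, three doublings lead from the kernel back to \<open>s\<close>; this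
      is the source of \<open>D ^ 3\<close>.\<close>
    have lower: "\<Phi>2 s / D ^ 3 \<le> \<Phi>2 (kernel z w)" if w: "w \<in> carleson_square I l" for w
    proof -
      have "\<bar>(a + b) / 2 - Re w\<bar> \<le> l" 
        using w I \<open>a < b\<close> by (auto simp: carleson_square_def l_def abs_if field_simps)
      moreover have "\<bar>l + Im w\<bar> \<le> 2 * l" "Im w > 0"
        using w by (auto simp: carleson_square_def)
      ultimately have "((a + b) / 2 - Re w)\<^sup>2 \<le> l\<^sup>2" "(l + Im w)\<^sup>2 \<le> (2 * l)\<^sup>2"
        using \<open>l > 0\<close> by (auto simp only: abs_le_square_iff[symmetric] abs_of_pos)
      moreover have eq: "(cmod (z - cnj w))\<^sup>2 = ((a + b) / 2 - Re w)\<^sup>2 + (l + Im w)\<^sup>2"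
        by (simp add: cmod_power2 z_def)
      ultimately have le: "(cmod (z - cnj w))\<^sup>2 \<le> 8 * l\<^sup>2"
        by (simp add: power_mult_distrib) (use zero_le_power2[of l] in linarith)
      have gt: "(cmod (z - cnj w))\<^sup>2 > 0"
        using \<open>l > 0\<close> \<open>Im w > 0\<close> unfolding eq by (intro add_nonneg_pos) auto
      have "s * (cmod (z - cnj w))\<^sup>2 \<le> s * (8 * l\<^sup>2)"
        using le \<open>s > 0\<close> by (intro mult_left_mono) auto
      moreover have "kernel z w = s * l\<^sup>2 / (cmod (z - cnj w))\<^sup>2"
        by (simp add: kernel_def z_def s_def)
      then have "2 ^ 3 * kernel z w * (cmod (z - cnj w))\<^sup>2 = s * (8 * l\<^sup>2)"
        using gt by simp
      ultimately have "s * (cmod (z - cnj w))\<^sup>2 \<le> 2 ^ 3 * kernel z w * (cmod (z - cnj w))\<^sup>2"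
        by simp
      then have "s \<le> 2 ^ 3 * kernel z w"
        using gt by (rule mult_right_le_imp_le)
      then have "\<Phi>2 s \<le> \<Phi>2 (2 ^ 3 * kernel z w)"
        using \<open>s > 0\<close> by (intro \<Phi>2.mono) auto
      also have "\<dots> \<le> D ^ 3 * \<Phi>2 (kernel z w)"
        by (intro doubling_power kernel_nonneg) (use \<open>l > 0\<close> in \<open>simp add: z_def\<close>)
      finally show ?thesis
        using D_pos by (simp add: field_simps)
    qed
    have "ennreal (\<Phi>2 s / D ^ 3) * emeasure \<mu> (carleson_square I l)
        = (\<integral>\<^sup>+w. ennreal (\<Phi>2 s / D ^ 3) * indicator (carleson_square I l) w \<partial>\<mu>)"
      by (subst nn_integral_cmult_indicator) auto
    also have "\<dots> \<le> (\<integral>\<^sup>+ w\<in>\<complex>\<^sub>+. ennreal (\<Phi>2 (kernel z w)) \<partial>\<mu>)"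
      using lower by (intro nn_integral_mono)
        (auto simp: indicator_def upper_half_plane_def carleson_square_def intro!: ennreal_leI)
    also have "\<dots> \<le> ennreal C"
      using assms \<open>l > 0\<close> by (auto simp: testing_def upper_half_plane_def z_def)
    finally have "ennreal (D ^ 3 / \<Phi>2 s) * (ennreal (\<Phi>2 s / D ^ 3) * emeasure \<mu> (carleson_square I l))
        \<le> ennreal (D ^ 3 / \<Phi>2 s) * ennreal C"
      by (intro mult_left_mono) auto
    moreover have "ennreal (D ^ 3 / \<Phi>2 s) * ennreal (\<Phi>2 s / D ^ 3) = 1"
      using \<open>\<Phi>2 s > 0\<close> D_pos by (subst ennreal_mult[symmetric]) auto
    ultimately show "emeasure \<mu> (carleson_square I (b - a))
        \<le> ennreal (D ^ 3 * C / \<Phi>2 (ginv \<Phi>1 (1 / (b - a))))"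
      using \<open>\<Phi>2 s > 0\<close> D_pos \<open>C > 0\<close> unfolding l_def[symmetric] s_def[symmetric]
      by (simp add: mult.assoc[symmetric] ennreal_mult[symmetric])
  qed
qed

text \<open>The kernel decays like \<open>4 ^ k\<close> in the denominator over the squares
  \<open>Q k\<close>. One factor \<open>2 ^ k\<close> is spent on comparing \<open>s\<close> with
  the inverse at the length of the k-th base; the other comes out of \<open>\<Phi>2\<close> by
  convexity and produces a geometric series of sum 2.\<close>

lemma carleson_imp_testing:
  assumes "carleson C" "C > 0"
  shows "\<exists>C'>0. testing C'"
proof (intro exI conjI)
  show "2 * C * D ^ 3 > 0"
    using \<open>C > 0\<close> D_pos by simp
  show "testing (2 * C * D ^ 3)"
    unfolding testing_def
  proof
    fix z assume "z \<in> \<complex>\<^sub>+"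
    define x y where "x = Re z" and "y = Im z"
    have "y > 0"
      using \<open>z \<in> \<complex>\<^sub>+\<close> by (simp add: upper_half_plane_def y_def)
    define s where "s = ginv \<Phi>1 (1 / y)"
    have "s > 0"
      unfolding s_def using \<open>y > 0\<close> by (simp add: \<Phi>1.ginv_pos)
    define Q where "Q k = carleson_square {x - 2 ^ k * y<..<x + 2 ^ k * y} (2 * (2 ^ k * y))" for k :: nat
    define c where "c k = \<Phi>2 (s * 4 / 4 ^ k)" for k :: nat
    have cover: "\<exists>k. w \<in> Q k \<and> \<Phi>2 (kernel z w) \<le> c k" if "w \<in> \<complex>\<^sub>+" for w
    proof -
      have "Im w > 0"
        using that by (simp add: upper_half_plane_def)
      obtain k0 where "(\<bar>Re w - x\<bar> + Im w) / y < 2 ^ k0"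
        using real_arch_pow[of 2] by auto
      then have "\<bar>Re w - x\<bar> + Im w < 2 ^ k0 * y"
        using \<open>y > 0\<close> by (simp add: field_simps)
      then have ex: "w \<in> Q k0"
        using \<open>Im w > 0\<close> by (auto simp: Q_def carleson_square_def)
      \<comment> \<open>Minimality matters: lying outside the preceding square forces
        \<open>w\<close> away from \<open>z\<close>, which bounds the kernel from above.\<close>
      define k where "k = (LEAST k. w \<in> Q k)"
      have k: "w \<in> Q k" and least: "\<And>j. j < k \<Longrightarrow> w \<notin> Q j"
        unfolding k_def using ex by (auto intro: LeastI dest: not_less_Least)
      have eq: "(cmod (z - cnj w))\<^sup>2 = (x - Re w)\<^sup>2 + (y + Im w)\<^sup>2"
        by (simp add: cmod_power2 x_def y_def)
      \<comment> \<open>For \<open>k = 0\<close> there is no preceding square, and the bound comes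
        from the distance being at least \<open>y\<close>. For \<open>k = Suc j\<close> the distance
        is at least \<open>2 ^ j * y\<close>; the factor 4 makes up for the shift of the
        index.\<close>
      have le: "y\<^sup>2 * 4 ^ k \<le> (cmod (z - cnj w))\<^sup>2 * 4"
      proof (cases k)
        case 0
        have "y\<^sup>2 \<le> (y + Im w)\<^sup>2"
          using \<open>y > 0\<close> \<open>Im w > 0\<close> by (intro power_mono) auto
        moreover have "q \<le> (p + q) * 4" if "0 \<le> p" "0 \<le> q" for p q :: real
          using that by simp
        ultimately show ?thesis
          unfolding eq 0 power_0 mult_1_right by (meson order_trans zero_le_power2)
      next
        case (Suc j)
        have "w \<notin> Q j"
          using least Suc by simp
        then have "\<bar>x - Re w\<bar> \<ge> 2 ^ j * y \<or> y + Im w \<ge> 2 ^ j * y"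
          using \<open>Im w > 0\<close> \<open>y > 0\<close> by (auto simp: Q_def carleson_square_def abs_if)
        then have "(2 ^ j * y)\<^sup>2 \<le> (x - Re w)\<^sup>2 \<or> (2 ^ j * y)\<^sup>2 \<le> (y + Im w)\<^sup>2"
          using \<open>y > 0\<close> \<open>Im w > 0\<close> by (auto simp: abs_le_square_iff[symmetric] intro: power_mono)
        then have "(2 ^ j * y)\<^sup>2 \<le> (cmod (z - cnj w))\<^sup>2"
          unfolding eq using zero_le_power2[of "x - Re w"] zero_le_power2[of "y + Im w"] by linarith
        moreover have "(2 ^ j * y)\<^sup>2 = y\<^sup>2 * 4 ^ j"
          by (simp add: power_mult_distrib power2_eq_square power_mult_distrib[symmetric])
        ultimately show ?thesis
          using Suc by simp
      qed
      have gt: "(cmod (z - cnj w))\<^sup>2 > 0"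
        unfolding eq using \<open>y > 0\<close> \<open>Im w > 0\<close> by (intro add_nonneg_pos) auto
      have "y\<^sup>2 / (cmod (z - cnj w))\<^sup>2 \<le> 4 / 4 ^ k"
        using le gt by (simp add: field_simps)
      then have "s * (y\<^sup>2 / (cmod (z - cnj w))\<^sup>2) \<le> s * (4 / 4 ^ k)"
        using \<open>s > 0\<close> by (intro mult_left_mono) auto
      then have "kernel z w \<le> s * 4 / 4 ^ k"
        by (simp add: kernel_def y_def s_def)
      then have "\<Phi>2 (kernel z w) \<le> c k"
        unfolding c_def using kernel_nonneg[of z w] \<open>y > 0\<close> by (intro \<Phi>2.mono) (auto simp: y_def)
      with k show ?thesis
        by blast
    qed
    have Q_meas: "Q k \<in> sets \<mu>" for k
      unfolding Q_def using \<open>y > 0\<close> by (intro square_in_sets) simp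
    have "(\<integral>\<^sup>+ w\<in>\<complex>\<^sub>+. ennreal (\<Phi>2 (kernel z w)) \<partial>\<mu>)
        \<le> (\<integral>\<^sup>+k. ennreal (c k) * emeasure \<mu> (Q k) \<partial>count_space UNIV)"
      using cover by (intro nn_integral_le_cover Q_meas) (force simp: indicator_def intro: ennreal_leI split: if_splits)+
    also have "\<dots> \<le> (\<integral>\<^sup>+k. ennreal (C * D ^ 3 * (1 / 2) ^ (k::nat)) \<partial>count_space UNIV)"
    proof (rule nn_integral_mono)
      fix k :: nat
      define l where "l = 2 ^ k * y"
      have "l > 0"
        using \<open>y > 0\<close> by (simp add: l_def)
      define t where "t = ginv \<Phi>1 (1 / (2 * l))"
      have "t > 0"
        unfolding t_def using \<open>l > 0\<close> by (intro \<Phi>1.ginv_pos) auto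
      have four: "(4::real) ^ k = 2 ^ k * 2 ^ k"
        by (simp flip: power_mult_distrib)
      \<comment> \<open>The base of \<open>Q k\<close> has length \<open>2 ^ (k + 1) * y\<close>, so
        \<open>s / 2 ^ (k + 1)\<close> is at most \<open>t\<close> by concavity of the inverse. The
        remaining constant is 8, absorbed by three doublings.\<close>
      have "s * 4 / 4 ^ k = (1 / 2) ^ k * (2 ^ 3 * (1 / 2 ^ (k + 1) * s))"
        by (simp add: power_divide four)
      also have "\<dots> \<le> (1 / 2) ^ k * (2 ^ 3 * t)"
      proof -
        have "1 / 2 ^ (k + 1) * s \<le> ginv \<Phi>1 (1 / 2 ^ (k + 1) * (1 / y))"
          unfolding s_def using \<open>y > 0\<close> one_le_power[of "2::real" "k + 1"]
          by (intro \<Phi>1.scale_ginv_le) auto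
        also have "\<dots> = t"
          by (simp add: t_def l_def mult.assoc)
        finally show ?thesis
          by (intro mult_left_mono) auto
      qed
      finally have "c k \<le> \<Phi>2 ((1 / 2) ^ k * (2 ^ 3 * t))"
        unfolding c_def using \<open>s > 0\<close> by (intro \<Phi>2.mono) auto
      also have "\<dots> \<le> (1 / 2) ^ k * \<Phi>2 (2 ^ 3 * t)"
        using \<open>t > 0\<close> by (intro \<Phi>2.scale_le) (auto intro: power_le_one)
      also have "\<dots> \<le> (1 / 2) ^ k * (D ^ 3 * \<Phi>2 t)"
        using \<open>t > 0\<close> by (intro mult_left_mono doubling_power) auto
      finally have ck: "c k \<le> (1 / 2) ^ k * (D ^ 3 * \<Phi>2 t)" .
      have "ennreal (c k) * emeasure \<mu> (Q k) \<le> ennreal ((1 / 2) ^ k * (D ^ 3 * \<Phi>2 t)) * ennreal (C * carl (2 * l))"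
        unfolding Q_def l_def[symmetric] using ck \<open>l > 0\<close>
        by (intro mult_mono ennreal_leI carlesonD assms) auto
      also have "\<dots> = ennreal ((1 / 2) ^ k * (D ^ 3 * \<Phi>2 t) * (C * (1 / \<Phi>2 t)))"
        using \<open>t > 0\<close> \<Phi>2.pos[of t] D_pos \<open>C > 0\<close>
        by (subst ennreal_mult) (auto simp: carl_def t_def)
      also have "(1 / 2) ^ k * (D ^ 3 * \<Phi>2 t) * (C * (1 / \<Phi>2 t)) = C * D ^ 3 * (1 / 2) ^ k"
        using \<Phi>2.pos[OF \<open>t > 0\<close>] by simp
      finally show "ennreal (c k) * emeasure \<mu> (Q k) \<le> ennreal (C * D ^ 3 * (1 / 2) ^ k)" .
    qed
    also have "\<dots> = ennreal (C * D ^ 3 * 2)"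
      unfolding nn_integral_count_space_nat by (rule suminf_ennreal_half_powers) (use \<open>C > 0\<close> D_pos in auto)
    finally show "(\<integral>\<^sup>+ w\<in>\<complex>\<^sub>+. ennreal (\<Phi>2 (kernel z w)) \<partial>\<mu>) \<le> ennreal (2 * C * D ^ 3)"
      by (simp add: mult_ac)
  qed
qed

end

section \<open>The Poisson estimate\<close>

lemma nn_integral_scale:
  assumes [measurable]: "h \<in> borel_measurable borel" and "a < b"
  shows "(\<integral>\<^sup>+s\<in>{0..1}. ennreal (b - a) * h (a + (b - a) * s) \<partial>lborel) = (\<integral>\<^sup>+x\<in>{a..b}. h x \<partial>lborel)"
proof -
  have "(\<integral>\<^sup>+x\<in>{a..b}. h x \<partial>lborel) =
      ennreal \<bar>b - a\<bar> * (\<integral>\<^sup>+s. h (a + (b - a) * s) * indicator {a..b} (a + (b - a) * s) \<partial>lborel)"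
    using \<open>a < b\<close> by (intro nn_integral_real_affine) auto
  also have "\<dots> = (\<integral>\<^sup>+s. ennreal (b - a) * (h (a + (b - a) * s) * indicator {a..b} (a + (b - a) * s)) \<partial>lborel)"
    using \<open>a < b\<close> by (subst nn_integral_cmult) auto
  also have "\<dots> = (\<integral>\<^sup>+s\<in>{0..1}. ennreal (b - a) * h (a + (b - a) * s) \<partial>lborel)"
  proof (rule nn_integral_cong)
    fix s
    have "a + (b - a) * s \<in> {a..b} \<longleftrightarrow> s \<in> {0..1}"
    proof -
      have "a + (b - a) * s \<le> b \<longleftrightarrow> (b - a) * s \<le> (b - a) * 1"
        by auto
      then show ?thesis
        using \<open>a < b\<close> by (simp only: mult_le_cancel_left_pos) (simp add: zero_le_mult_iff)
    qed
    then show "ennreal (b - a) * (h (a + (b - a) * s) * indicator {a..b} (a + (b - a) * s)) =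
        ennreal (b - a) * h (a + (b - a) * s) * indicator {0..1} s"
      by (simp add: indicator_def)
  qed
  finally show ?thesis ..
qed

text \<open>The bound lives in the extended nonnegative reals, so it can later be averaged by
  Tonelli's theorem; \<open>B\<close> may take infinite values.\<close>

lemma cmod_contour_integral_linepath_le:
  assumes cont: "continuous_on (closed_segment a b) h"
    and bound: "\<And>s. s \<in> {0..1} \<Longrightarrow> ennreal (cmod (h (linepath a b s)) * cmod (b - a)) \<le> B s"
  shows "ennreal (cmod (contour_integral (linepath a b) h)) \<le> (\<integral>\<^sup>+s\<in>{0..1}. B s \<partial>lborel)"
proof -
  have cont': "continuous_on {0..1} (\<lambda>s. h (linepath a b s) * (b - a))"
    by (intro continuous_intros continuous_on_compose2[OF cont])
       (auto simp: linepath_in_path path_image_linepath)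
  have "contour_integral (linepath a b) h = integral {0..1} (\<lambda>s. h (linepath a b s) * (b - a))"
    by (simp add: contour_integral_integral)
  then have "cmod (contour_integral (linepath a b) h)
      \<le> integral {0..1} (\<lambda>s. cmod (h (linepath a b s) * (b - a)))"
    using cont' by (simp only:) (intro integral_norm_bound_integral integrable_continuous_real continuous_on_norm; simp)
  then have "ennreal (cmod (contour_integral (linepath a b) h))
      \<le> ennreal (integral {0..1} (\<lambda>s. cmod (h (linepath a b s) * (b - a))))"
    by (rule ennreal_leI)
  also have "\<dots> = (\<integral>\<^sup>+s\<in>{0..1}. ennreal (cmod (h (linepath a b s) * (b - a))) \<partial>lborel)"
    using cont' by (intro nn_integral_has_integral_lebesgue'[symmetric] integrable_integral
        integrable_continuous_real continuous_on_norm) auto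
  also have "\<dots> \<le> (\<integral>\<^sup>+s\<in>{0..1}. B s \<partial>lborel)"
    using bound by (intro nn_integral_mono) (auto simp: norm_mult indicator_def)
  finally show ?thesis .
qed

lemma cmod_contour_integral_horizontal_le:
  assumes h: "continuous_on (closed_segment (Complex a y) (Complex b y)) h" and "a < b"
    and [measurable]: "g \<in> borel_measurable borel"
    and bound: "\<And>x. x \<in> {a..b} \<Longrightarrow> ennreal (cmod (h (Complex x y))) \<le> g x"
  shows "ennreal (cmod (contour_integral (linepath (Complex a y) (Complex b y)) h)) \<le> (\<integral>\<^sup>+x\<in>{a..b}. g x \<partial>lborel)"
proof -
  have eq: "linepath (Complex a y) (Complex b y) s = Complex (a + (b - a) * s) y" for s
    by (simp add: linepath_def complex_eq_iff algebra_simps)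
  have len: "cmod (Complex b y - Complex a y) = b - a"
    using \<open>a < b\<close> by (simp add: cmod_def)
  have "ennreal (cmod (contour_integral (linepath (Complex a y) (Complex b y)) h))
      \<le> (\<integral>\<^sup>+s\<in>{0..1}. ennreal (b - a) * g (a + (b - a) * s) \<partial>lborel)"
  proof (rule cmod_contour_integral_linepath_le[OF h])
    fix s :: real assume s: "s \<in> {0..1}"
    then have "(b - a) * s \<le> (b - a) * 1" "0 \<le> (b - a) * s"
      using \<open>a < b\<close> by (auto intro!: mult_left_mono)
    then have "ennreal (cmod (h (Complex (a + (b - a) * s) y))) \<le> g (a + (b - a) * s)"
      by (intro bound) auto
    then have "ennreal (cmod (h (Complex (a + (b - a) * s) y))) * ennreal (b - a) \<le> g (a + (b - a) * s) * ennreal (b - a)"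
      by (rule mult_right_mono) simp
    then show "ennreal (cmod (h (linepath (Complex a y) (Complex b y) s)) * cmod (Complex b y - Complex a y))
        \<le> ennreal (b - a) * g (a + (b - a) * s)"
      using \<open>a < b\<close> unfolding eq len by (simp add: ennreal_mult mult.commute)
  qed
  also have "\<dots> = (\<integral>\<^sup>+x\<in>{a..b}. g x \<partial>lborel)"
    by (rule nn_integral_scale) (use \<open>a < b\<close> in auto)
  finally show ?thesis .
qed

lemma cmod_contour_integral_vertical_le:
  assumes h: "continuous_on (closed_segment (Complex x 0) (Complex x T)) h" and "0 < T"
    and [measurable]: "g \<in> borel_measurable borel"
    and bound: "\<And>s. s \<in> {0..1} \<Longrightarrow> cmod (h (Complex x (T * s))) * T \<le> c * g s" and "c \<ge> 0"
  shows "ennreal (cmod (contour_integral (linepath (Complex x 0) (Complex x T)) h))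
    \<le> ennreal c * (\<integral>\<^sup>+s\<in>{0..1}. ennreal (g s) \<partial>lborel)"
proof -
  have eq: "linepath (Complex x 0) (Complex x T) s = Complex x (T * s)" for s
    by (simp add: linepath_def complex_eq_iff algebra_simps)
  have len: "cmod (Complex x T - Complex x 0) = T"
    using \<open>0 < T\<close> by (simp add: cmod_def)
  have "ennreal (cmod (contour_integral (linepath (Complex x 0) (Complex x T)) h))
      \<le> (\<integral>\<^sup>+s\<in>{0..1}. ennreal c * ennreal (g s) \<partial>lborel)"
    using bound \<open>c \<ge> 0\<close> unfolding ennreal_mult'[OF \<open>c \<ge> 0\<close>, symmetric]
    by (intro cmod_contour_integral_linepath_le[OF h]) (auto simp: eq len intro!: ennreal_leI)
  also have "\<dots> = ennreal c * (\<integral>\<^sup>+s\<in>{0..1}. ennreal (g s) \<partial>lborel)"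
    by (subst nn_integral_cmult[symmetric]) (auto simp: mult.assoc)
  finally show ?thesis .
qed

text \<open>By Tonelli, the integral over \<open>R\<close> in \<open>{N..2*N}\<close> of the
  vertical integrals is at most \<open>2 * B * N\<close>: the lines at \<open>R\<close> and
  \<open>-R\<close> sweep out disjoint parts of \<open>{-(2*N)..2*N}\<close>. The range of
  \<open>R\<close> has length \<open>N\<close>, so the vertical integral cannot exceed
  \<open>6 * B\<close> throughout; the slack over \<open>2 * B\<close> makes the contradiction
  strict.\<close>

lemma exists_small_vertical_average:
  fixes G :: "real \<times> real \<Rightarrow> real"
  assumes cont: "continuous_on UNIV G" and nonneg: "\<And>p. G p \<ge> 0"
    and B: "\<And>s. s \<in> {0..1} \<Longrightarrow> (\<integral>\<^sup>+x\<in>{-(2*N)..2*N}. ennreal (G (x, s)) \<partial>lborel) \<le> ennreal (2 * B * N)"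
    and "N > 0" "B > 0"
  obtains R where "N \<le> R" "R \<le> 2 * N"
    "(\<integral>\<^sup>+s\<in>{0..1}. ennreal (G (R, s) + G (-R, s)) \<partial>lborel) \<le> ennreal (6 * B)"
proof -
  have [measurable]: "G \<in> borel_measurable borel"
    using cont by (rule borel_measurable_continuous_onI)
  define A where "A R = (\<integral>\<^sup>+s\<in>{0..1}. ennreal (G (R, s) + G (-R, s)) \<partial>lborel)" for R
  have half: "(\<integral>\<^sup>+R\<in>{N..2*N}. ennreal (G (R, s) + G (-R, s)) \<partial>lborel) \<le> ennreal (2 * B * N)"
    if "s \<in> {0..1}" for s
  proof -
    have "(\<integral>\<^sup>+R\<in>{N..2*N}. ennreal (G (R, s) + G (-R, s)) \<partial>lborel)
       = (\<integral>\<^sup>+R\<in>{N..2*N}. ennreal (G (R, s)) \<partial>lborel) + (\<integral>\<^sup>+R\<in>{N..2*N}. ennreal (G (-R, s)) \<partial>lborel)"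
      using nonneg by (subst nn_integral_add[symmetric]) (auto intro!: nn_integral_cong simp: indicator_def)
    also have "(\<integral>\<^sup>+R\<in>{N..2*N}. ennreal (G (-R, s)) \<partial>lborel) =
        (\<integral>\<^sup>+R. ennreal (G (R, s)) * indicator {N..2*N} (-R) \<partial>lborel)"
      by (subst nn_integral_real_affine[where c = "-1" and t = 0]) auto
    also have "(\<integral>\<^sup>+R\<in>{N..2*N}. ennreal (G (R, s)) \<partial>lborel) + \<dots> =
        (\<integral>\<^sup>+R. ennreal (G (R, s)) * indicator {N..2*N} R + ennreal (G (R, s)) * indicator {N..2*N} (-R) \<partial>lborel)"
      by (subst nn_integral_add[symmetric]) auto
    also have "\<dots> \<le> (\<integral>\<^sup>+x\<in>{-(2*N)..2*N}. ennreal (G (x, s)) \<partial>lborel)"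
      using \<open>N > 0\<close> by (intro nn_integral_mono) (auto simp: indicator_def)
    finally show ?thesis
      using B[OF that] by simp
  qed
  have "(\<integral>\<^sup>+R\<in>{N..2*N}. A R \<partial>lborel)
      = (\<integral>\<^sup>+R. (\<integral>\<^sup>+s. ennreal (G (R, s) + G (-R, s)) * indicator {0..1} s * indicator {N..2*N} R \<partial>lborel) \<partial>lborel)"
    unfolding A_def by (subst nn_integral_multc) auto
  also have "\<dots> = (\<integral>\<^sup>+s. (\<integral>\<^sup>+R. ennreal (G (R, s) + G (-R, s)) * indicator {0..1} s * indicator {N..2*N} R \<partial>lborel) \<partial>lborel)"
    by (rule lborel_pair.Fubini'[symmetric]) measurable
  also have "\<dots> \<le> (\<integral>\<^sup>+s\<in>{0..1::real}. ennreal (2 * B * N) \<partial>lborel)"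
    using half by (intro nn_integral_mono) (auto simp: indicator_def)
  also have "\<dots> = ennreal (2 * B * N)"
    by (subst nn_integral_cmult_indicator) auto
  finally have total: "(\<integral>\<^sup>+R\<in>{N..2*N}. A R \<partial>lborel) \<le> ennreal (2 * B * N)" .
  have "\<exists>R\<in>{N..2*N}. A R \<le> ennreal (6 * B)"
  proof (rule ccontr)
    assume "\<not> ?thesis"
    then have "(\<integral>\<^sup>+R\<in>{N..2*N}. ennreal (6 * B) \<partial>lborel) \<le> (\<integral>\<^sup>+R\<in>{N..2*N}. A R \<partial>lborel)"
      by (intro nn_integral_mono) (auto simp: indicator_def not_le less_imp_le)
    also note total
    also have "(\<integral>\<^sup>+R\<in>{N..2*N}. ennreal (6 * B) \<partial>lborel) = ennreal (6 * B * N)"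
      using \<open>N > 0\<close> \<open>B > 0\<close> by (subst nn_integral_cmult_indicator) (auto simp: ennreal_mult)
    finally show False
      using \<open>N > 0\<close> \<open>B > 0\<close> by (simp add: ennreal_le_iff)
  qed
  then show thesis
    unfolding A_def using that by auto
qed

text \<open>
  Cauchy's formula for \<open>F(w)/(w - cnj z)\<close> on rectangles produces the Poisson kernel. Since \<open>F\<close> is only
  controlled on average, the abscissa \<open>R \<in> [N, 2N]\<close> of the vertical sides has to be chosen by averaging.
\<close>

lemma poisson_estimate:
  fixes F :: "complex \<Rightarrow> complex"
  assumes "\<delta> > 0" and hol: "F holomorphic_on {w. Im w > - \<delta>}"
    and lin: "\<And>y R. y \<ge> 0 \<Longrightarrow> R \<ge> 1 \<Longrightarrow> (\<integral>\<^sup>+x\<in>{-R..R}. ennreal (cmod (F (Complex x y))) \<partial>lborel) \<le> ennreal (B * R)"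
    and "B > 0" and "Im z > 0"
  shows "ennreal (pi * cmod (F z) / Im z)
    \<le> (\<integral>\<^sup>+t. ennreal (cmod (F (Complex t 0)) / (cmod (Complex t 0 - z))\<^sup>2) \<partial>lborel)" (is "?X \<le> ?P")
proof -
  \<comment> \<open>The half plane has to contain the closed upper half plane but not
    \<open>cnj z\<close>, the pole of \<open>H\<close>.\<close>
  define S where "S = {w. Im w > - min \<delta> (Im z)}"
  have S_convex: "convex S" "open S"
    unfolding S_def by (auto intro: convex_halfspace_Im_gt open_halfspace_Im_gt)
  have F_S: "F holomorphic_on S"
    by (rule holomorphic_on_subset[OF hol]) (auto simp: S_def)
  \<comment> \<open>On the real line \<open>cnj z\<close> and \<open>z\<close> are equally distant,
    so \<open>H w / (w - z)\<close> has the modulus of \<open>F\<close> times the Poisson kernel up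
    to a constant. The additional factor also gives the quadratic decay needed on the other three
    sides.\<close>
  define H where "H w = F w / (w - cnj z)" for w
  have ne_cnj: "w \<noteq> cnj z" if "w \<in> S" for w
    using that by (auto simp: S_def)
  have H_S: "H holomorphic_on S"
    unfolding H_def by (intro holomorphic_intros F_S) (use ne_cnj in auto)
  define h where "h w = H w / (w - z)" for w
  have h_cont: "continuous_on (S - {z}) h"
    unfolding h_def
    by (intro continuous_intros holomorphic_on_imp_continuous_on holomorphic_on_subset[OF H_S]) auto
  have cmod_h: "cmod (h w) = cmod (F w) / (cmod (w - cnj z) * cmod (w - z))" for w
    by (simp add: h_def H_def norm_divide norm_mult)
  \<comment> \<open>Truncation by \<open>max 0\<close> gives a function continuous on the whole
    plane, as the averaging lemma requires. The scale \<open>c\<close> is 1 for measurability and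
    \<open>2 * N\<close> for the vertical sides.\<close>
  have F_cont: "continuous_on UNIV (\<lambda>p. cmod (F (Complex (fst p) (c * max 0 (snd p)))))" if "c \<ge> 0" for c :: real
  proof (intro continuous_on_norm continuous_on_compose2[OF holomorphic_on_imp_continuous_on[OF F_S]])
    show "continuous_on UNIV (\<lambda>p. Complex (fst p) (c * max 0 (snd p)))"
      by (simp add: Complex_eq) (intro continuous_intros)
    have "0 \<le> c * max 0 v" for v
      using that by simp
    then have "- min \<delta> (Im z) < c * max 0 v" for v
      using \<open>\<delta> > 0\<close> \<open>Im z > 0\<close> by (smt (verit))
    then show "(\<lambda>p. Complex (fst p) (c * max 0 (snd p))) ` UNIV \<subseteq> S"
      by (auto simp: S_def)
  qed
  have F_meas [measurable]: "(\<lambda>x. cmod (F (Complex x y))) \<in> borel_measurable borel" if "y \<ge> 0" for y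
  proof (rule borel_measurable_continuous_onI)
    have "continuous_on UNIV (\<lambda>x. (x, y))"
      by (intro continuous_intros)
    then show "continuous_on UNIV (\<lambda>x. cmod (F (Complex x y)))"
      using continuous_on_compose2[OF F_cont[of 1], of UNIV "\<lambda>x. (x, y)"] that by simp
  qed
  have [measurable]: "(\<lambda>t. cmod (Complex t 0 - z)) \<in> borel_measurable borel"
    by (intro borel_measurable_continuous_onI) (simp add: Complex_eq, intro continuous_intros)
  \<comment> \<open>Error budget: the two vertical sides together contribute
    \<open>8 / N * (6 * B)\<close>, the top side contributes \<open>8 * B / N\<close>, in total
    \<open>56 * B / N\<close>.\<close>
  have main: "?X \<le> ?P + ennreal (56 * B / N)" if N: "N \<ge> 2 * cmod z + 1" for N
  proof -
    have "N \<ge> 1" "N > 0" "cmod z \<le> N / 2"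
      using N norm_ge_zero[of z] by linarith+
    define G where "G p = cmod (F (Complex (fst p) (2 * N * max 0 (snd p))))" for p
    have G_nonneg: "G p \<ge> 0" for p
      by (simp add: G_def)
    have G_cont: "continuous_on UNIV G"
      unfolding G_def using \<open>N > 0\<close> by (intro F_cont) auto
    have "(\<integral>\<^sup>+x\<in>{-(2*N)..2*N}. ennreal (G (x, s)) \<partial>lborel) \<le> ennreal (2 * B * N)" if "s \<in> {0..1}" for s
      using lin[of "2 * N * s" "2 * N"] that \<open>N \<ge> 1\<close> by (simp add: G_def mult_ac max_def)
    then obtain R where R: "N \<le> R" "R \<le> 2 * N"
      and avg: "(\<integral>\<^sup>+s\<in>{0..1}. ennreal (G (R, s) + G (-R, s)) \<partial>lborel) \<le> ennreal (6 * B)"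
      using exists_small_vertical_average[OF G_cont, of N B] \<open>B > 0\<close> \<open>N > 0\<close> by (auto simp: G_def)
    have "Re z \<le> N / 2" "- Re z \<le> N / 2" "Im z \<le> N / 2"
      using \<open>cmod z \<le> N / 2\<close> complex_Re_le_cmod[of z] abs_Re_le_cmod[of z] abs_Im_le_cmod[of z] by linarith+
    then have box: "z \<in> box (Complex (- R) 0) (Complex R (2 * N))"
      using R \<open>N > 0\<close> \<open>Im z > 0\<close> by (auto simp: in_box_complex_iff)
    let ?a1 = "Complex (- R) 0" and ?a2 = "Complex R 0" and ?a3 = "Complex R (2 * N)"
      and ?a4 = "Complex (- R) (2 * N)"
    have "w \<in> S" if "w \<in> cbox ?a1 ?a3" for w
      using that \<open>\<delta> > 0\<close> \<open>Im z > 0\<close> unfolding S_def in_cbox_complex_iff by (simp add: min_def)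
    moreover have "path_image (rectpath ?a1 ?a3) = cbox ?a1 ?a3 - box ?a1 ?a3"
      using R \<open>N > 0\<close> by (intro path_image_rectpath_cbox_minus_box) auto
    ultimately have img: "path_image (rectpath ?a1 ?a3) \<subseteq> S - {z}"
      using box by blast
    have "closed_segment ?a1 ?a2 \<subseteq> path_image (rectpath ?a1 ?a3)"
      "closed_segment ?a2 ?a3 \<subseteq> path_image (rectpath ?a1 ?a3)"
      "closed_segment ?a3 ?a4 \<subseteq> path_image (rectpath ?a1 ?a3)"
      "closed_segment ?a4 ?a1 \<subseteq> path_image (rectpath ?a1 ?a3)"
      by (auto simp: rectpath_def Let_def path_image_join)
    then have cont: "continuous_on (closed_segment ?a1 ?a2) h" "continuous_on (closed_segment ?a2 ?a3) h"
      "continuous_on (closed_segment ?a3 ?a4) h" "continuous_on (closed_segment ?a4 ?a1) h"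
      using img by (auto intro!: continuous_on_subset[OF h_cont])
    have "(h has_contour_integral (2 * pi * \<i> * winding_number (rectpath ?a1 ?a3) z * H z)) (rectpath ?a1 ?a3)"
      unfolding h_def
    proof (rule Cauchy_integral_formula_convex_simple[OF S_convex(1) H_S])
      show "z \<in> interior S"
        using \<open>\<delta> > 0\<close> \<open>Im z > 0\<close> S_convex by (simp add: interior_open) (simp add: S_def)
    qed (use img in auto)
    then have "contour_integral (rectpath ?a1 ?a3) h = 2 * pi * \<i> * H z"
      using winding_number_rectpath[OF box] by (simp add: contour_integral_unique)
    moreover have "contour_integral (rectpath ?a1 ?a3) h =
        contour_integral (linepath ?a1 ?a2) h + (contour_integral (linepath ?a2 ?a3) h +
        (contour_integral (linepath ?a3 ?a4) h + contour_integral (linepath ?a4 ?a1) h))"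
      using cont by (simp add: rectpath_def Let_def contour_integrable_continuous_linepath)
    moreover have "contour_integral (linepath ?a3 ?a4) h = - contour_integral (linepath ?a4 ?a3) h"
      "contour_integral (linepath ?a4 ?a1) h = - contour_integral (linepath ?a1 ?a4) h"
      using cont by (simp_all add: contour_integral_reverse_linepath)
    ultimately have eq: "2 * pi * \<i> * H z =
        contour_integral (linepath ?a1 ?a2) h + (contour_integral (linepath ?a2 ?a3) h
        - contour_integral (linepath ?a4 ?a3) h - contour_integral (linepath ?a1 ?a4) h)"
      by (simp add: algebra_simps)
    have "cmod (2 * pi * \<i> * H z) \<le> cmod (contour_integral (linepath ?a1 ?a2) h)
        + (cmod (contour_integral (linepath ?a2 ?a3) h) + cmod (contour_integral (linepath ?a4 ?a3) h)
        + cmod (contour_integral (linepath ?a1 ?a4) h))"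
      unfolding eq by (intro order_trans[OF norm_triangle_ineq] order_trans[OF norm_triangle_ineq4] add_mono order_refl)
    then have "ennreal (cmod (2 * pi * \<i> * H z)) \<le> ennreal (cmod (contour_integral (linepath ?a1 ?a2) h))
        + (ennreal (cmod (contour_integral (linepath ?a2 ?a3) h)) + ennreal (cmod (contour_integral (linepath ?a4 ?a3) h))
        + ennreal (cmod (contour_integral (linepath ?a1 ?a4) h)))"
      by (simp flip: ennreal_plus add: ennreal_leI)
    also have "\<dots> \<le> ?P + (ennreal (8 / N) * (\<integral>\<^sup>+s\<in>{0..1}. ennreal (G (R, s)) \<partial>lborel) + ennreal (8 * B / N)
        + ennreal (8 / N) * (\<integral>\<^sup>+s\<in>{0..1}. ennreal (G (-R, s)) \<partial>lborel))"
    proof (intro add_mono)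
      have "ennreal (cmod (contour_integral (linepath ?a1 ?a2) h))
          \<le> (\<integral>\<^sup>+t\<in>{-R..R}. ennreal (cmod (F (Complex t 0)) / (cmod (Complex t 0 - z))\<^sup>2) \<partial>lborel)"
      proof (rule cmod_contour_integral_horizontal_le[OF cont(1)])
        fix t
        have "cmod (Complex t 0 - cnj z) = cmod (Complex t 0 - z)"
          by (simp add: cmod_def)
        then show "ennreal (cmod (h (Complex t 0))) \<le> ennreal (cmod (F (Complex t 0)) / (cmod (Complex t 0 - z))\<^sup>2)"
          by (simp add: cmod_h power2_eq_square)
        show "(\<lambda>t. ennreal (cmod (F (Complex t 0)) / (cmod (Complex t 0 - z))\<^sup>2)) \<in> borel_measurable borel"
          by measurable
      qed (use R \<open>N > 0\<close> in auto)
      also have "\<dots> \<le> ?P"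
        by (intro nn_integral_mono) (auto simp: indicator_def)
      finally show "ennreal (cmod (contour_integral (linepath ?a1 ?a2) h)) \<le> ?P" .
    next
      \<comment> \<open>The point has modulus at least \<open>N\<close> while \<open>z\<close> and
        \<open>cnj z\<close> have modulus at most \<open>N / 2\<close>, so both factors of the
        denominator are at least \<open>N / 2\<close>.\<close>
      have far: "cmod (h (Complex u v)) \<le> cmod (F (Complex u v)) * (4 / N\<^sup>2)" if "\<bar>u\<bar> \<ge> N \<or> v \<ge> N" for u v
      proof -
        have "N \<le> cmod (Complex u v)"
          using that abs_Re_le_cmod[of "Complex u v"] abs_Im_le_cmod[of "Complex u v"] by auto
        then have "N / 2 \<le> cmod (Complex u v - z)" "N / 2 \<le> cmod (Complex u v - cnj z)"
          using norm_triangle_ineq2[of "Complex u v" z] norm_triangle_ineq2[of "Complex u v" "cnj z"]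
            \<open>cmod z \<le> N / 2\<close> by auto
        then have "N / 2 * (N / 2) \<le> cmod (Complex u v - cnj z) * cmod (Complex u v - z)"
          using \<open>N > 0\<close> by (intro mult_mono) auto
        then have "cmod (h (Complex u v)) \<le> cmod (F (Complex u v)) / (N / 2 * (N / 2))"
          unfolding cmod_h using \<open>N > 0\<close> by (intro frac_le) auto
        then show ?thesis
          by (simp add: power2_eq_square)
      qed
      have side: "ennreal (cmod (contour_integral (linepath (Complex u 0) (Complex u (2 * N))) h))
          \<le> ennreal (8 / N) * (\<integral>\<^sup>+s\<in>{0..1}. ennreal (G (u, s)) \<partial>lborel)"
        if "continuous_on (closed_segment (Complex u 0) (Complex u (2 * N))) h" "\<bar>u\<bar> \<ge> N" for u
      proof (rule cmod_contour_integral_vertical_le[OF that(1)])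
        fix s :: real assume "s \<in> {0..1}"
        then have "cmod (h (Complex u (2 * N * s))) * (2 * N) \<le> G (u, s) * (4 / N\<^sup>2) * (2 * N)"
          using far[of u "2 * N * s"] that(2) \<open>N > 0\<close> by (intro mult_right_mono) (auto simp: G_def max_def)
        then show "cmod (h (Complex u (2 * N * s))) * (2 * N) \<le> 8 / N * G (u, s)"
          using \<open>N > 0\<close> by (simp add: power2_eq_square field_simps)
      next
        have "continuous_on UNIV (\<lambda>s. G (u, s))"
          by (rule continuous_on_compose2[OF G_cont]) (auto intro!: continuous_intros)
        then show "(\<lambda>s. G (u, s)) \<in> borel_measurable borel"
          by (rule borel_measurable_continuous_onI)
      qed (use \<open>N > 0\<close> in auto)
      show "ennreal (cmod (contour_integral (linepath ?a2 ?a3) h))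
          \<le> ennreal (8 / N) * (\<integral>\<^sup>+s\<in>{0..1}. ennreal (G (R, s)) \<partial>lborel)"
        using cont R by (intro side) auto
      show "ennreal (cmod (contour_integral (linepath ?a1 ?a4) h))
          \<le> ennreal (8 / N) * (\<integral>\<^sup>+s\<in>{0..1}. ennreal (G (-R, s)) \<partial>lborel)"
        using cont(4) R by (intro side) (auto simp: closed_segment_commute)
      have *: "0 \<le> 4 / N\<^sup>2"
        by simp
      have "ennreal (cmod (contour_integral (linepath ?a4 ?a3) h))
          \<le> (\<integral>\<^sup>+x\<in>{-R..R}. ennreal (cmod (F (Complex x (2 * N))) * (4 / N\<^sup>2)) \<partial>lborel)"
      proof (rule cmod_contour_integral_horizontal_le)
        show "continuous_on (closed_segment ?a4 ?a3) h"
          using cont(3) by (simp add: closed_segment_commute)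
        show "ennreal (cmod (h (Complex x (2 * N)))) \<le> ennreal (cmod (F (Complex x (2 * N))) * (4 / N\<^sup>2))" for x
          using \<open>N > 0\<close> by (intro ennreal_leI far) auto
        show "(\<lambda>x. ennreal (cmod (F (Complex x (2 * N))) * (4 / N\<^sup>2))) \<in> borel_measurable borel"
          using F_meas[of "2 * N"] \<open>N > 0\<close> by simp
      qed (use R \<open>N > 0\<close> in auto)
      also have "\<dots> = ennreal (4 / N\<^sup>2) * (\<integral>\<^sup>+x\<in>{-R..R}. ennreal (cmod (F (Complex x (2 * N)))) \<partial>lborel)"
        using F_meas[of "2 * N"] \<open>N > 0\<close> unfolding mult.commute[of _ "4 / N\<^sup>2"] ennreal_mult'[OF *]
        by (subst nn_integral_cmult[symmetric]) (auto simp: mult.assoc)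
      also have "\<dots> \<le> ennreal (4 / N\<^sup>2) * ennreal (B * R)"
        using R \<open>N \<ge> 1\<close> by (intro mult_left_mono lin) auto
      also have "\<dots> \<le> ennreal (4 / N\<^sup>2) * ennreal (B * (2 * N))"
        using R \<open>B > 0\<close> by (intro mult_left_mono ennreal_leI) auto
      also have "\<dots> = ennreal (8 * B / N)"
        using \<open>N > 0\<close> \<open>B > 0\<close> by (subst ennreal_mult[symmetric]) (auto simp: power2_eq_square)
      finally show "ennreal (cmod (contour_integral (linepath ?a4 ?a3) h)) \<le> ennreal (8 * B / N)" .
    qed
    also have "\<dots> = ?P + (ennreal (8 / N) * ((\<integral>\<^sup>+s\<in>{0..1}. ennreal (G (R, s)) \<partial>lborel)
        + (\<integral>\<^sup>+s\<in>{0..1}. ennreal (G (-R, s)) \<partial>lborel)) + ennreal (8 * B / N))"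
      by (simp add: distrib_left add_ac)
    also have "(\<integral>\<^sup>+s\<in>{0..1}. ennreal (G (R, s)) \<partial>lborel) + (\<integral>\<^sup>+s\<in>{0..1}. ennreal (G (-R, s)) \<partial>lborel)
        = (\<integral>\<^sup>+s\<in>{0..1}. ennreal (G (R, s) + G (-R, s)) \<partial>lborel)"
    proof -
      have [measurable]: "G \<in> borel_measurable borel"
        using G_cont by (rule borel_measurable_continuous_onI)
      show ?thesis
        by (subst nn_integral_add[symmetric]) (auto simp: G_nonneg indicator_def intro!: nn_integral_cong)
    qed
    also have "?P + (ennreal (8 / N) * \<dots> + ennreal (8 * B / N)) \<le> ?P + (ennreal (8 / N) * ennreal (6 * B) + ennreal (8 * B / N))"
      by (intro add_mono mult_left_mono avg order_refl) auto
    also have "ennreal (8 / N) * ennreal (6 * B) + ennreal (8 * B / N) = ennreal (56 * B / N)"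
      using \<open>N > 0\<close> \<open>B > 0\<close> by (simp flip: ennreal_mult ennreal_plus add: field_simps)
    also have "cmod (2 * pi * \<i> * H z) = pi * cmod (F z) / Im z"
    proof -
      have "cmod (z - cnj z) = 2 * Im z"
        using \<open>Im z > 0\<close> by (simp add: complex_diff_cnj norm_mult)
      then show ?thesis
        by (simp add: H_def norm_mult norm_divide)
    qed
    finally show ?thesis .
  qed
  show ?thesis
  proof (rule ennreal_le_epsilon)
    fix e :: real assume "e > 0"
    define N where "N = max (2 * cmod z + 1) (56 * B / e)"
    have "N > 0"
      using \<open>B > 0\<close> \<open>e > 0\<close> by (auto simp: N_def less_max_iff_disj)
    moreover have "56 * B / e \<le> N"
      by (simp add: N_def)
    ultimately have "56 * B / N \<le> e"
      using \<open>e > 0\<close> by (simp add: field_simps)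
    have "?X \<le> ?P + ennreal (56 * B / N)"
      by (rule main) (simp add: N_def)
    also have "\<dots> \<le> ?P + ennreal e"
      using \<open>56 * B / N \<le> e\<close> by (intro add_left_mono ennreal_leI)
    finally show "?X \<le> ?P + ennreal e" .
  qed
qed

section \<open>Large values force large boundary averages\<close>

lemma exists_power_two_between:
  fixes u :: real
  obtains k where "u < 2 ^ k" "2 ^ k \<le> 2 * max 1 u"
proof -
  obtain k0 where k0: "u < 2 ^ k0"
    using real_arch_pow[of 2 u] by auto
  define k where "k = (LEAST k. u < 2 ^ k)"
  have k: "u < 2 ^ k" and least: "\<And>j. j < k \<Longrightarrow> \<not> u < 2 ^ j"
    unfolding k_def using k0 by (auto intro: LeastI dest: not_less_Least)
  have "2 ^ k \<le> 2 * max 1 u"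
    using least[of "k - 1"] by (cases k) auto
  with k that show thesis
    by blast
qed

text \<open>Every \<open>t\<close> lies in a dyadic interval of radius \<open>2 ^ k * y\<close> on
  which the kernel at \<open>t\<close> is at most \<open>4 / (4 ^ k * y\<^sup>2)\<close>. The mass
  of that interval is at most \<open>4 * L * 2 ^ k * y\<close>, so the k-th contribution is
  \<open>16 * L / y\<close> over \<open>2 ^ k\<close>, and the series doubles the leading
  term.\<close>

lemma poisson_integral_le:
  fixes h :: "real \<Rightarrow> real"
  assumes [measurable]: "h \<in> borel_measurable borel" and nonneg: "\<And>t. h t \<ge> 0"
    and "y > 0" "L \<ge> 0"
    and avg: "\<And>r. r \<ge> y \<Longrightarrow> (\<integral>\<^sup>+t\<in>{x-r<..<x+r}. ennreal (h t) \<partial>lborel) \<le> ennreal (4 * L * r)"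
  shows "(\<integral>\<^sup>+t. ennreal (h t / (cmod (Complex t 0 - Complex x y))\<^sup>2) \<partial>lborel) \<le> ennreal (32 * L / y)"
proof -
  \<comment> \<open>With \<open>h\<close> absorbed into the measure, the covering bound applies to
    the kernel alone.\<close>
  define M where "M = density lborel (\<lambda>t. ennreal (h t))"
  define S where "S k = {x - 2 ^ k * y<..<x + 2 ^ k * y}" for k :: nat
  have sq: "(cmod (Complex t 0 - Complex x y))\<^sup>2 = (t - x)\<^sup>2 + y\<^sup>2" for t
    by (simp add: cmod_power2)
  have [measurable]: "(\<lambda>t. 1 / (cmod (Complex t 0 - Complex x y))\<^sup>2) \<in> borel_measurable borel"
    unfolding sq by measurable
  have "(\<integral>\<^sup>+t. ennreal (h t / (cmod (Complex t 0 - Complex x y))\<^sup>2) \<partial>lborel)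
      = (\<integral>\<^sup>+t. ennreal (1 / (cmod (Complex t 0 - Complex x y))\<^sup>2) \<partial>M)"
    unfolding M_def using nonneg
    by (subst nn_integral_density) (auto simp: ennreal_mult[symmetric])
  also have "\<dots> \<le> (\<integral>\<^sup>+k. ennreal (4 / (4 ^ k * y\<^sup>2)) * emeasure M (S k) \<partial>count_space UNIV)"
  proof (rule nn_integral_le_cover)
    fix t
    obtain k where k: "\<bar>t - x\<bar> / y < 2 ^ k" "2 ^ k \<le> 2 * max 1 (\<bar>t - x\<bar> / y)"
      by (rule exists_power_two_between)
    have "2 ^ k * y \<le> 2 * max 1 (\<bar>t - x\<bar> / y) * y"
      using k(2) \<open>y > 0\<close> by (intro mult_right_mono) auto
    also have "\<dots> = 2 * max y \<bar>t - x\<bar>"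
      using \<open>y > 0\<close> by (auto simp: max_def field_simps)
    finally have "(2 ^ k * y)\<^sup>2 \<le> (2 * max y \<bar>t - x\<bar>)\<^sup>2"
      using \<open>y > 0\<close> by (intro power_mono) auto
    also have "\<dots> \<le> 4 * ((t - x)\<^sup>2 + y\<^sup>2)"
      by (auto simp: max_def power_mult_distrib)
    also have "(2 ^ k * y)\<^sup>2 = 4 ^ k * y\<^sup>2"
      by (simp add: power2_eq_square flip: power_mult_distrib)
    finally have "4 ^ k * y\<^sup>2 \<le> 4 * ((t - x)\<^sup>2 + y\<^sup>2)" .
    moreover have "(t - x)\<^sup>2 + y\<^sup>2 > 0"
      using \<open>y > 0\<close> by (intro add_nonneg_pos) auto
    ultimately have "1 / (cmod (Complex t 0 - Complex x y))\<^sup>2 \<le> 4 / (4 ^ k * y\<^sup>2)"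
      unfolding sq using \<open>y > 0\<close> by (simp add: field_simps)
    moreover have "t \<in> S k"
      using k(1) \<open>y > 0\<close> by (auto simp: S_def field_simps abs_less_iff)
    ultimately show "\<exists>k\<in>UNIV. t \<in> S k \<and> ennreal (1 / (cmod (Complex t 0 - Complex x y))\<^sup>2) \<le> ennreal (4 / (4 ^ k * y\<^sup>2))"
      by (auto intro!: ennreal_leI)
  qed (auto simp: M_def S_def)
  also have "\<dots> \<le> (\<integral>\<^sup>+k. ennreal (16 * L / y * (1 / 2) ^ (k::nat)) \<partial>count_space UNIV)"
  proof (rule nn_integral_mono)
    fix k :: nat
    have "y \<le> 2 ^ k * y"
      using \<open>y > 0\<close> by simp
    have "emeasure M (S k) = (\<integral>\<^sup>+t\<in>{x - 2 ^ k * y<..<x + 2 ^ k * y}. ennreal (h t) \<partial>lborel)"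
      unfolding M_def S_def by (subst emeasure_density) auto
    also have "\<dots> \<le> ennreal (4 * L * (2 ^ k * y))"
      using \<open>y \<le> 2 ^ k * y\<close> by (rule avg)
    finally have "ennreal (4 / (4 ^ k * y\<^sup>2)) * emeasure M (S k) \<le> ennreal (4 / (4 ^ k * y\<^sup>2)) * ennreal (4 * L * (2 ^ k * y))"
      by (rule mult_left_mono) simp
    also have "\<dots> = ennreal (4 / (4 ^ k * y\<^sup>2) * (4 * L * (2 ^ k * y)))"
      using \<open>y > 0\<close> \<open>L \<ge> 0\<close> by (subst ennreal_mult) auto
    also have "4 / (4 ^ k * y\<^sup>2) * (4 * L * (2 ^ k * y)) = 16 * L / y * (1 / 2) ^ k"
    proof -
      have "(4::real) ^ k = 2 ^ k * 2 ^ k"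
        by (simp flip: power_mult_distrib)
      then show ?thesis
        using \<open>y > 0\<close> by (simp add: power2_eq_square power_divide)
    qed
    finally show "ennreal (4 / (4 ^ k * y\<^sup>2)) * emeasure M (S k) \<le> ennreal (16 * L / y * (1 / 2) ^ k)" .
  qed
  also have "\<dots> = ennreal (16 * L / y * 2)"
    unfolding nn_integral_count_space_nat by (rule suminf_ennreal_half_powers) (use \<open>y > 0\<close> \<open>L \<ge> 0\<close> in auto)
  finally show ?thesis
    by (simp add: mult_ac)
qed

text \<open>If all these averages were small, the two Poisson bounds would give
  \<open>pi * cmod (F z) \<le> 32 * L\<close>. The crude estimate \<open>pi \<ge> 2\<close> then
  yields \<open>16 * L\<close>, which explains the threshold.\<close>

lemma large_value_imp_large_average:
  fixes F :: "complex \<Rightarrow> complex"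
  assumes "\<delta> > 0" and hol: "F holomorphic_on {w. Im w > - \<delta>}"
    and lin: "\<And>y R. y \<ge> 0 \<Longrightarrow> R \<ge> 1 \<Longrightarrow> (\<integral>\<^sup>+x\<in>{-R..R}. ennreal (cmod (F (Complex x y))) \<partial>lborel) \<le> ennreal (B * R)"
    and "B > 0" and "Im z > 0" and "L > 0" and large: "cmod (F z) > 16 * L"
  obtains r where "r \<ge> Im z"
    "(\<integral>\<^sup>+t\<in>{Re z-r<..<Re z+r}. ennreal (cmod (F (Complex t 0))) \<partial>lborel) > ennreal (4 * L * r)"
proof (rule ccontr)
  assume "\<not> thesis"
  then have "(\<integral>\<^sup>+t\<in>{Re z-r<..<Re z+r}. ennreal (cmod (F (Complex t 0))) \<partial>lborel) \<le> ennreal (4 * L * r)"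
    if "r \<ge> Im z" for r
    using \<open>r \<ge> Im z\<close> \<open>\<And>r. r \<ge> Im z \<Longrightarrow> _ \<Longrightarrow> thesis\<close> by (meson not_le)
  moreover have "continuous_on UNIV (\<lambda>t. cmod (F (Complex t 0)))"
    using \<open>\<delta> > 0\<close>
    by (intro continuous_on_norm continuous_on_compose2[OF holomorphic_on_imp_continuous_on[OF hol]])
       (auto simp: Complex_eq intro!: continuous_intros)
  ultimately have "(\<integral>\<^sup>+t. ennreal (cmod (F (Complex t 0)) / (cmod (Complex t 0 - Complex (Re z) (Im z)))\<^sup>2) \<partial>lborel)
      \<le> ennreal (32 * L / Im z)"
    using \<open>Im z > 0\<close> \<open>L > 0\<close> by (intro poisson_integral_le borel_measurable_continuous_onI) auto
  then have "ennreal (pi * cmod (F z) / Im z) \<le> ennreal (32 * L / Im z)"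
    using poisson_estimate[OF assms(1-5)] by simp
  then have "pi * cmod (F z) \<le> 32 * L"
    using \<open>Im z > 0\<close> \<open>L > 0\<close> by (simp add: ennreal_le_iff divide_le_cancel)
  moreover have "2 * cmod (F z) \<le> pi * cmod (F z)"
    using pi_ge_two by (intro mult_right_mono) auto
  ultimately show False
    using large by simp
qed

section \<open>The Carleson embedding\<close>

text \<open>Pointwise \<open>h\<close> is at most \<open>1 + \<Phi> h / \<Phi> 1\<close>, since
  chord slopes increase beyond 1. The resulting linear growth in \<open>R\<close> is the
  integrability hypothesis of the Poisson estimate.\<close>

lemma (in convex_growth) nn_integral_le_linear:
  fixes h :: "real \<Rightarrow> real"
  assumes [measurable]: "h \<in> borel_measurable borel" and h_nonneg: "\<And>x. h x \<ge> 0"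
    and le1: "(\<integral>\<^sup>+x. ennreal (\<Phi> (h x)) \<partial>lborel) \<le> 1" and "R \<ge> 1"
  shows "(\<integral>\<^sup>+x\<in>{-R..R}. ennreal (h x) \<partial>lborel) \<le> ennreal ((2 + 1 / \<Phi> 1) * R)"
proof -
  have "(\<integral>\<^sup>+x\<in>{-R..R}. ennreal (h x) \<partial>lborel)
      \<le> (\<integral>\<^sup>+x. indicator {-R..R} x + ennreal (1 / \<Phi> 1) * ennreal (\<Phi> (h x)) \<partial>lborel)"
  proof (rule nn_integral_mono)
    fix x
    have "h x \<le> 1 + 1 / \<Phi> 1 * \<Phi> (h x)"
    proof (cases "h x \<le> 1")
      case True
      then show ?thesis
        using nonneg[of "h x"] h_nonneg[of x] pos[of 1] by (simp add: add_increasing2)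
    next
      case False
      then have "\<Phi> 1 * h x \<le> \<Phi> (h x) * 1"
        by (intro ratio_le) auto
      then show ?thesis
        using pos[of 1] by (simp add: field_simps)
    qed
    then have "ennreal (h x) \<le> ennreal (1 + 1 / \<Phi> 1 * \<Phi> (h x))"
      by (rule ennreal_leI)
    also have "\<dots> = 1 + ennreal (1 / \<Phi> 1) * ennreal (\<Phi> (h x))"
      using pos[of 1] h_nonneg[of x] by (subst ennreal_mult[symmetric]) (auto simp: nonneg)
    finally show "ennreal (h x) * indicator {-R..R} x
        \<le> indicator {-R..R} x + ennreal (1 / \<Phi> 1) * ennreal (\<Phi> (h x))"
      by (auto simp: indicator_def)
  qed
  also have "\<dots> = ennreal (2 * R) + ennreal (1 / \<Phi> 1) * (\<integral>\<^sup>+x. ennreal (\<Phi> (h x)) \<partial>lborel)"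
    using h_nonneg \<open>R \<ge> 1\<close> by (simp add: nn_integral_add nn_integral_cmult)
  also have "\<dots> \<le> ennreal (2 * R) + ennreal (1 / \<Phi> 1) * 1"
    by (intro add_left_mono mult_left_mono le1) simp
  also have "\<dots> \<le> ennreal ((2 + 1 / \<Phi> 1) * R)"
  proof -
    have "1 / \<Phi> 1 * 1 \<le> 1 / \<Phi> 1 * R"
      using \<open>R \<ge> 1\<close> pos[of 1] by (intro mult_left_mono) auto
    then show ?thesis
      using \<open>R \<ge> 1\<close> pos[of 1] by (simp flip: ennreal_plus add: ennreal_leI distrib_right)
  qed
  finally show ?thesis .
qed

text \<open>Beyond \<open>L\<close> the chord slope is at least \<open>\<Phi> L / L\<close>. This
  Chebyshev-type bound controls the total mass of a function truncated from below.\<close>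

lemma (in convex_growth) truncation_le:
  assumes "L > 0" "t \<ge> 0"
  shows "ennreal t * indicator {L<..} t \<le> ennreal (L / \<Phi> L) * ennreal (\<Phi> t)"
proof (cases "t > L")
  case True
  then have "\<Phi> L * t \<le> \<Phi> t * L"
    using assms by (intro ratio_le) auto
  then have "t \<le> L / \<Phi> L * \<Phi> t"
    using pos[of L] assms by (simp add: field_simps)
  then have "ennreal t \<le> ennreal (L / \<Phi> L * \<Phi> t)"
    by (rule ennreal_leI)
  also have "\<dots> = ennreal (L / \<Phi> L) * ennreal (\<Phi> t)"
    using assms pos[of L] by (intro ennreal_mult nonneg) auto
  finally show ?thesis
    using True by simp
qed simp

section \<open>Level set estimates\<close>

locale dilation_measure = growth_measure +
  fixes a :: real
  assumes a_gt_1: "a > 1" and dilation: "\<And>u. u \<ge> 0 \<Longrightarrow> 2 * a * \<Phi>1 u \<le> \<Phi>1 (a * u)"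

text \<open>An upward shift makes a function in the unit ball of the Hardy space holomorphic up to the
  boundary.\<close>
locale hardy_function = dilation_measure +
  fixes F :: "complex \<Rightarrow> complex" and \<delta> :: real
  assumes \<delta>_pos: "\<delta> > 0" and hol: "F holomorphic_on {w. Im w > - \<delta>}"
    and le1: "\<And>y. y \<ge> 0 \<Longrightarrow> (\<integral>\<^sup>+x. ennreal (\<Phi>1 (cmod (F (Complex x y)))) \<partial>lborel) \<le> 1"
begin

definition g :: "real \<Rightarrow> real" where "g t = cmod (F (Complex t 0))"

lemma g_nonneg [simp]: "g t \<ge> 0"
  by (simp add: g_def)

lemma horizontal_measurable:
  assumes "y \<ge> 0"
  shows "(\<lambda>x. cmod (F (Complex x y))) \<in> borel_measurable borel"
proof (rule borel_measurable_continuous_onI)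
  show "continuous_on UNIV (\<lambda>x. cmod (F (Complex x y)))"
    using \<delta>_pos assms
    by (intro continuous_on_norm continuous_on_compose2[OF holomorphic_on_imp_continuous_on[OF hol]])
       (auto simp: Complex_eq intro!: continuous_intros)
qed

lemma g_measurable [measurable]: "g \<in> borel_measurable borel"
  using horizontal_measurable[of 0] by (simp add: g_def[abs_def])

lemma truncation_measurable [measurable]:
  "(\<lambda>t. ennreal (g t) * indicator {L<..} (g t)) \<in> borel_measurable borel"
  by measurable

lemma open_level: "open {z \<in> \<complex>\<^sub>+. cmod (F z) > c}"
proof -
  have "continuous_on \<complex>\<^sub>+ (\<lambda>z. cmod (F z))"
    using \<delta>_pos
    by (intro continuous_on_norm continuous_on_subset[OF holomorphic_on_imp_continuous_on[OF hol]])
       (auto simp: upper_half_plane_def)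
  then have "open ((\<lambda>z. cmod (F z)) -` {c<..} \<inter> \<complex>\<^sub>+)"
    unfolding upper_half_plane_def by (subst (asm) continuous_on_open_vimage) (auto intro: open_halfspace_Im_gt)
  then show ?thesis
    by (simp add: vimage_def Int_def conj_commute)
qed

lemma level_measurable [measurable]: "{z \<in> \<complex>\<^sub>+. cmod (F z) > c} \<in> sets \<mu>"
  using open_level sets_eq by auto

text \<open>On an interval of length \<open>2 * r\<close>, the values of \<open>g\<close> up to
  \<open>L\<close> contribute at most \<open>2 * L * r\<close>. Of an integral exceeding
  \<open>4 * L * r\<close>, at least \<open>2 * L * r\<close> thus comes from \<open>g > L\<close>.
  Closed balls are the form used by the Vitali lemma.\<close>

lemma large_average:
  assumes "z \<in> \<complex>\<^sub>+" "L > 0" "cmod (F z) > 16 * L"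
  shows "\<exists>r\<ge>Im z. ennreal (2 * L * r) \<le> (\<integral>\<^sup>+t\<in>cball (Re z) r. ennreal (g t) * indicator {L<..} (g t) \<partial>lborel)"
proof -
  have "Im z > 0"
    using assms by (simp add: upper_half_plane_def)
  have lin: "(\<integral>\<^sup>+x\<in>{-R..R}. ennreal (cmod (F (Complex x y))) \<partial>lborel) \<le> ennreal ((2 + 1 / \<Phi>1 1) * R)"
    if "y \<ge> 0" "R \<ge> 1" for y R
    using that by (intro \<Phi>1.nn_integral_le_linear horizontal_measurable le1) auto
  have "2 + 1 / \<Phi>1 1 > 0"
    using \<Phi>1.pos[of 1] by (simp add: add_pos_pos)
  then obtain r where "r \<ge> Im z" and
    r: "ennreal (4 * L * r) < (\<integral>\<^sup>+t\<in>{Re z-r<..<Re z+r}. ennreal (g t) \<partial>lborel)"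
    unfolding g_def
    using large_value_imp_large_average[OF \<delta>_pos hol lin _ \<open>Im z > 0\<close> \<open>L > 0\<close> assms(3)] by blast
  then have "r > 0"
    using \<open>Im z > 0\<close> by simp
  have "ennreal (2 * L * r) \<le> (\<integral>\<^sup>+t\<in>cball (Re z) r. ennreal (g t) * indicator {L<..} (g t) \<partial>lborel)"
  proof (rule ccontr)
    assume "\<not> ?thesis"
    then have small: "(\<integral>\<^sup>+t\<in>cball (Re z) r. ennreal (g t) * indicator {L<..} (g t) \<partial>lborel) \<le> ennreal (2 * L * r)"
      by simp
    have "(\<integral>\<^sup>+t\<in>{Re z-r<..<Re z+r}. ennreal (g t) \<partial>lborel)
        \<le> (\<integral>\<^sup>+t. ennreal L * indicator (cball (Re z) r) t
              + ennreal (g t) * indicator {L<..} (g t) * indicator (cball (Re z) r) t \<partial>lborel)"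
      by (intro nn_integral_mono) (auto simp: indicator_def dist_real_def intro!: ennreal_leI)
    also have "\<dots> = ennreal L * emeasure lborel (cball (Re z) r)
        + (\<integral>\<^sup>+t\<in>cball (Re z) r. ennreal (g t) * indicator {L<..} (g t) \<partial>lborel)"
    proof (subst nn_integral_add)
      have [measurable]: "cball (Re z) r \<in> sets borel"
        by (rule borel_closed) simp
      show "(\<lambda>t. ennreal L * indicator (cball (Re z) r) t) \<in> borel_measurable lborel"
        "(\<lambda>t. ennreal (g t) * indicator {L<..} (g t) * indicator (cball (Re z) r) t) \<in> borel_measurable lborel"
        by measurable
    qed (simp add: nn_integral_cmult_indicator)
    also have "\<dots> \<le> ennreal L * ennreal (2 * r) + ennreal (2 * L * r)"
      using small \<open>r > 0\<close> by (intro add_mono mult_left_mono) (auto simp: cball_eq_atLeastAtMost)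
    also have "\<dots> = ennreal (4 * L * r)"
      using \<open>L > 0\<close> \<open>r > 0\<close> by (simp flip: ennreal_mult ennreal_plus)
    finally show False
      using r by simp
  qed
  with \<open>r \<ge> Im z\<close> show ?thesis
    by blast
qed

text \<open>Each point of the level set sees an interval of radius \<open>r z \<ge> Im z\<close>
  carrying mass at least \<open>2 * L * r z\<close> of the truncated \<open>g\<close>. Vitali
  selects disjoint intervals whose fivefold enlargements carry Carleson squares covering the level
  set. The measure of each square is bounded by the mass of its own interval, and the disjoint
  masses add up.\<close>

lemma emeasure_level_le:
  assumes "carleson C" "C > 0" "L > 0"
  shows "emeasure \<mu> {z \<in> \<complex>\<^sub>+. cmod (F z) > 16 * L} \<le>
    ennreal (C * D ^ 3 * \<Phi>1 L / (L * \<Phi>2 L)) * (\<integral>\<^sup>+t. ennreal (g t) * indicator {L<..} (g t) \<partial>lborel)"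
proof -
  define E where "E = {z \<in> \<complex>\<^sub>+. cmod (F z) > 16 * L}"
  define M where "M = density lborel (\<lambda>t. ennreal (g t) * indicator {L<..} (g t))"
  have sets_M [simp]: "sets M = sets borel"
    by (simp add: M_def)
  have M_eq: "emeasure M A = (\<integral>\<^sup>+t\<in>A. ennreal (g t) * indicator {L<..} (g t) \<partial>lborel)" if "A \<in> sets borel" for A
    unfolding M_def using that by (subst emeasure_density) auto
  have "\<Phi>1 L > 0" "\<Phi>2 L > 0"
    using \<open>L > 0\<close> \<Phi>1.pos \<Phi>2.pos by auto
  \<comment> \<open>The bound on the modular makes the total mass of \<open>M\<close> finite. This
    bounds the radii from above, which is what the Vitali lemma requires.\<close>
  have M_le: "emeasure M A \<le> ennreal (L / \<Phi>1 L)" if "A \<in> sets borel" for A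
  proof -
    have "emeasure M A \<le> (\<integral>\<^sup>+t. ennreal (L / \<Phi>1 L) * ennreal (\<Phi>1 (g t)) \<partial>lborel)"
      unfolding M_eq[OF that] using \<Phi>1.truncation_le[OF \<open>L > 0\<close> g_nonneg]
      by (intro nn_integral_mono) (auto simp: indicator_def)
    also have "\<dots> = ennreal (L / \<Phi>1 L) * (\<integral>\<^sup>+t. ennreal (\<Phi>1 (g t)) \<partial>lborel)"
      by (rule nn_integral_cmult) (use g_nonneg in measurable)
    also have "\<dots> \<le> ennreal (L / \<Phi>1 L) * 1"
      using le1[of 0] by (intro mult_left_mono) (auto simp: g_def)
    finally show ?thesis
      by simp
  qed
  have "\<forall>z\<in>E. \<exists>r\<ge>Im z. ennreal (2 * L * r) \<le> emeasure M (cball (Re z) r)"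
  proof
    fix z assume "z \<in> E"
    with large_average[of z L] \<open>L > 0\<close> show "\<exists>r\<ge>Im z. ennreal (2 * L * r) \<le> emeasure M (cball (Re z) r)"
      by (simp add: E_def M_eq)
  qed
  then obtain r where r: "\<And>z. z \<in> E \<Longrightarrow> Im z \<le> r z"
      "\<And>z. z \<in> E \<Longrightarrow> ennreal (2 * L * r z) \<le> emeasure M (cball (Re z) (r z))"
    by metis
  have r_pos: "r z > 0" if "z \<in> E" for z
    using r(1)[OF that] that by (auto simp: E_def upper_half_plane_def)
  have r_le: "r z \<le> 1 / (2 * \<Phi>1 L)" if "z \<in> E" for z
  proof -
    have "ennreal (2 * L * r z) \<le> ennreal (L / \<Phi>1 L)"
      using r(2)[OF that] M_le[of "cball (Re z) (r z)"] by (meson borel_closed closed_cball order_trans)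
    then have "2 * L * r z \<le> L / \<Phi>1 L"
      using \<open>L > 0\<close> \<open>\<Phi>1 L > 0\<close> by (simp add: ennreal_le_iff)
    then show ?thesis
      using \<open>L > 0\<close> \<open>\<Phi>1 L > 0\<close> by (simp add: field_simps)
  qed
  have "\<And>z. z \<in> E \<Longrightarrow> 0 < r z \<and> r z \<le> 1 / (2 * \<Phi>1 L)"
    using r_pos r_le by blast
  then obtain J where J: "countable J" "J \<subseteq> E"
    and disj: "pairwise (\<lambda>i j. disjnt (cball (Re i) (r i)) (cball (Re j) (r j))) J"
    and cov: "\<And>z. z \<in> E \<Longrightarrow> \<exists>j. j \<in> J \<and> \<not> disjnt (cball (Re z) (r z)) (cball (Re j) (r j)) \<and>
      cball (Re z) (r z) \<subseteq> ball (Re j) (5 * r j)"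
    by (rule Vitali_covering_lemma_cballs_balls[where a = Re and r = r and K = E and B = "1 / (2 * \<Phi>1 L)"])
      (assumption, rule that)
  define Q where "Q j = carleson_square {Re j - 5 * r j<..<Re j + 5 * r j} (2 * (5 * r j))" for j
  \<comment> \<open>The enlarged interval contains both end points of the interval of
    \<open>z\<close>, so it is longer than \<open>r z\<close> and hence longer than
    \<open>Im z\<close>.\<close>
  have cover: "\<exists>j\<in>J. z \<in> Q j" if zE: "z \<in> E" for z
  proof -
    obtain j where "j \<in> J" and j: "cball (Re z) (r z) \<subseteq> ball (Re j) (5 * r j)"
      using cov[OF zE] by blast
    have "Re z \<in> cball (Re z) (r z)" "Re z + r z \<in> cball (Re z) (r z)" "Re z - r z \<in> cball (Re z) (r z)"
      using r_pos[OF zE] by (auto simp: dist_real_def)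
    then have *: "Re z \<in> ball (Re j) (5 * r j)" "Re z + r z \<in> ball (Re j) (5 * r j)"
      "Re z - r z \<in> ball (Re j) (5 * r j)"
      using j by blast+
    then have "r z < 2 * (5 * r j)"
      by (auto simp: dist_real_def abs_less_iff)
    then have "z \<in> Q j"
      using *(1) r(1)[OF zE] zE
      by (auto simp: Q_def carleson_square_def E_def upper_half_plane_def dist_real_def abs_less_iff)
    with \<open>j \<in> J\<close> show ?thesis
      by blast
  qed
  \<comment> \<open>The radii are at most \<open>1 / (2 * \<Phi>1 L)\<close>, so
    \<open>5 / \<Phi>1 L\<close> bounds the lengths \<open>10 * r j\<close> of all enlarged bases.
    It serves as the common reference length in \<open>carl_scale\<close>.\<close>
  define k where "k = carl (5 / \<Phi>1 L)"
  have "k > 0"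
    unfolding k_def using \<open>\<Phi>1 L > 0\<close> by (intro carl_pos) simp
  \<comment> \<open>Convexity gives \<open>L / 5\<close> as a lower bound for the inverse of
    \<open>\<Phi>1\<close> at \<open>\<Phi>1 L / 5\<close>. Since 5 is below \<open>2 ^ 3\<close>,
    the loss is three doublings.\<close>
  have k_le: "k \<le> D ^ 3 / \<Phi>2 L"
  proof -
    have "L / 5 \<le> ginv \<Phi>1 (1 / (5 / \<Phi>1 L))"
      using \<Phi>1.scale_le[of "1 / 5" L] \<Phi>1.le_ginv_iff[of "\<Phi>1 L / 5" "L / 5"] \<open>L > 0\<close> \<open>\<Phi>1 L > 0\<close>
      by simp
    then have "\<Phi>2 (L / 5) \<le> \<Phi>2 (ginv \<Phi>1 (1 / (5 / \<Phi>1 L)))"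
      using \<open>L > 0\<close> by (intro \<Phi>2.mono) auto
    moreover have "\<Phi>2 L \<le> D ^ 3 * \<Phi>2 (L / 5)"
    proof -
      have "\<Phi>2 L \<le> \<Phi>2 (2 ^ 3 * (L / 5))"
        using \<open>L > 0\<close> by (intro \<Phi>2.mono) auto
      also have "\<dots> \<le> D ^ 3 * \<Phi>2 (L / 5)"
        using \<open>L > 0\<close> by (intro doubling_power) auto
      finally show ?thesis .
    qed
    moreover have "\<Phi>2 (L / 5) > 0"
      using \<open>L > 0\<close> by (intro \<Phi>2.pos) auto
    ultimately have "k \<le> 1 / \<Phi>2 (L / 5)" "1 / \<Phi>2 (L / 5) \<le> D ^ 3 / \<Phi>2 L"
      unfolding k_def carl_def using \<open>\<Phi>2 L > 0\<close> by (auto simp: field_simps)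
    then show ?thesis
      by simp
  qed
  have "emeasure \<mu> E = (\<integral>\<^sup>+z. indicator E z \<partial>\<mu>)"
    unfolding E_def by (subst nn_integral_indicator) auto
  also have "\<dots> \<le> (\<integral>\<^sup>+j. 1 * emeasure \<mu> (Q j) \<partial>count_space J)"
  proof (rule nn_integral_le_cover[OF J(1)])
    show "Q j \<in> sets \<mu>" if "j \<in> J" for j
      unfolding Q_def using r_pos[of j] J(2) that by (intro square_in_sets) auto
  next
    fix z assume "indicator E z > (0::ennreal)"
    then have "z \<in> E"
      by (cases "z \<in> E") auto
    with cover show "\<exists>j\<in>J. z \<in> Q j \<and> indicator E z \<le> (1::ennreal)"
      by (auto simp: indicator_def)
  qed
  also have "\<dots> \<le> (\<integral>\<^sup>+j. ennreal (C * \<Phi>1 L * k / L) * emeasure M (cball (Re j) (r j)) \<partial>count_space J)"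
  proof (rule nn_integral_mono)
    fix j assume "j \<in> space (count_space J)"
    then have "j \<in> E"
      using J(2) by auto
    \<comment> \<open>Linear comparison with the reference length produces the factor
      \<open>r j\<close>, which is then exchanged for the mass of the j-th interval.\<close>
    have "carl (2 * (5 * r j)) \<le> 2 * (5 * r j) / (5 / \<Phi>1 L) * k"
      unfolding k_def using r_pos[OF \<open>j \<in> E\<close>] r_le[OF \<open>j \<in> E\<close>] \<open>\<Phi>1 L > 0\<close>
      by (intro carl_scale) (auto simp: field_simps)
    then have "C * carl (2 * (5 * r j)) \<le> C * (2 * (5 * r j) / (5 / \<Phi>1 L) * k)"
      using \<open>C > 0\<close> by (intro mult_left_mono) auto
    also have "\<dots> = C * \<Phi>1 L * k / L * (2 * L * r j)"
      using \<open>L > 0\<close> by simp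
    finally have le: "C * carl (2 * (5 * r j)) \<le> C * \<Phi>1 L * k / L * (2 * L * r j)" .
    have "emeasure \<mu> (Q j) \<le> ennreal (C * carl (2 * (5 * r j)))"
      unfolding Q_def using r_pos[OF \<open>j \<in> E\<close>] by (intro carlesonD assms) simp
    also have "\<dots> \<le> ennreal (C * \<Phi>1 L * k / L * (2 * L * r j))"
      using le by (rule ennreal_leI)
    also have "\<dots> = ennreal (C * \<Phi>1 L * k / L) * ennreal (2 * L * r j)"
      using \<open>C > 0\<close> \<open>L > 0\<close> \<open>k > 0\<close> \<open>\<Phi>1 L > 0\<close> r_pos[OF \<open>j \<in> E\<close>] by (intro ennreal_mult) auto
    also have "\<dots> \<le> ennreal (C * \<Phi>1 L * k / L) * emeasure M (cball (Re j) (r j))"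
      by (intro mult_left_mono r \<open>j \<in> E\<close>) simp
    finally show "1 * emeasure \<mu> (Q j) \<le> \<dots>"
      by simp
  qed
  also have "\<dots> = ennreal (C * \<Phi>1 L * k / L) * emeasure M (\<Union>j\<in>J. cball (Re j) (r j))"
  proof -
    have "disjoint_family_on (\<lambda>j. cball (Re j) (r j)) J"
      using disj by (auto simp: disjoint_family_on_def pairwise_def disjnt_def)
    then show ?thesis
      using J(1) by (subst emeasure_UN_countable) (auto simp: nn_integral_cmult)
  qed
  also have "\<dots> \<le> ennreal (C * D ^ 3 * \<Phi>1 L / (L * \<Phi>2 L)) * emeasure M UNIV"
  proof (intro mult_mono ennreal_leI emeasure_mono)
    have "C * \<Phi>1 L / L * k \<le> C * \<Phi>1 L / L * (D ^ 3 / \<Phi>2 L)"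
      using k_le \<open>C > 0\<close> \<open>L > 0\<close> \<open>\<Phi>1 L > 0\<close> by (intro mult_left_mono) auto
    then show "C * \<Phi>1 L * k / L \<le> C * D ^ 3 * \<Phi>1 L / (L * \<Phi>2 L)"
      by (simp add: mult_ac)
  qed auto
  finally show ?thesis
    by (simp add: M_eq E_def)
qed

end

section \<open>Summation over the levels and the embedding of the unit ball\<close>

context dilation_measure
begin

definition level :: "int \<Rightarrow> real" where "level j = a powr real_of_int j"

lemma level_pos [simp]: "level j > 0"
  using a_gt_1 by (simp add: level_def)

lemma level_less_iff: "t > 0 \<Longrightarrow> level j < t \<longleftrightarrow> j < \<lceil>log a t\<rceil>"
  using a_gt_1 by (simp add: level_def less_ceiling_iff less_log_iff)

lemma le_level_iff: "t > 0 \<Longrightarrow> t \<le> level j \<longleftrightarrow> \<lceil>log a t\<rceil> \<le> j"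
  using level_less_iff[of t j] by linarith

lemma level_diff: "level (j - int n) = level j / a ^ n"
  using a_gt_1 by (simp add: level_def powr_diff powr_realpow)

lemma dilation_power:
  assumes "u \<ge> 0"
  shows "(2 * a) ^ n * \<Phi>1 (u / a ^ n) \<le> \<Phi>1 u"
proof (induction n)
  case (Suc n)
  have "2 * a * \<Phi>1 (u / a ^ Suc n) \<le> \<Phi>1 (a * (u / a ^ Suc n))"
    using assms a_gt_1 by (intro dilation) auto
  then have "(2 * a) ^ n * (2 * a * \<Phi>1 (u / a ^ Suc n)) \<le> (2 * a) ^ n * \<Phi>1 (u / a ^ n)"
    using a_gt_1 by (intro mult_left_mono) auto
  with Suc show ?case
    by (simp add: mult_ac)
qed simp

text \<open>The dilation inequality doubles \<open>\<Phi>1 L / L\<close> whenever \<open>L\<close>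
  is multiplied by \<open>a\<close>. The sum over all levels below \<open>t\<close> is therefore at
  most twice its largest term, which is at most \<open>\<Phi>1 t / t\<close>.\<close>

lemma level_sum_le:
  assumes "t > 0"
  shows "(\<integral>\<^sup>+j. ennreal (\<Phi>1 (level j) / level j) * indicator {level j<..} t \<partial>count_space UNIV)
    \<le> ennreal (2 * \<Phi>1 t / t)"
proof -
  \<comment> \<open>The levels strictly below \<open>t\<close> are those with \<open>j < m\<close>,
    so \<open>m - 1\<close> is the index of the largest; the bijection enumerates them downwards
    from there.\<close>
  define m where "m = \<lceil>log a t\<rceil>"
  define s where "s = level (m - 1)"
  have s: "0 < s" "s < t"
    unfolding s_def using level_less_iff[OF assms] by (auto simp: m_def)
  have bij: "bij_betw (\<lambda>n. m - 1 - int n) UNIV {..<m}"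
    by (rule bij_betw_byWitness[where f' = "\<lambda>j. nat (m - 1 - j)"]) auto
  have "(\<integral>\<^sup>+j. ennreal (\<Phi>1 (level j) / level j) * indicator {level j<..} t \<partial>count_space UNIV)
      = (\<integral>\<^sup>+j. ennreal (\<Phi>1 (level j) / level j) * indicator {..<m} j \<partial>count_space UNIV)"
    using level_less_iff[OF assms] by (intro nn_integral_cong) (auto simp: indicator_def m_def)
  also have "\<dots> = (\<integral>\<^sup>+j. ennreal (\<Phi>1 (level j) / level j) \<partial>count_space {..<m})"
    by (simp add: nn_integral_count_space_indicator)
  also have "\<dots> = (\<integral>\<^sup>+n. ennreal (\<Phi>1 (level (m - 1 - int n)) / level (m - 1 - int n)) \<partial>count_space UNIV)"
    by (rule nn_integral_bij_count_space[OF bij, symmetric])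
  also have "\<dots> \<le> (\<integral>\<^sup>+n. ennreal (\<Phi>1 t / t * (1 / 2) ^ n) \<partial>count_space UNIV)"
  proof (intro nn_integral_mono ennreal_leI)
    fix n
    have "\<Phi>1 (s / a ^ n) / (s / a ^ n) = (2 * a) ^ n * \<Phi>1 (s / a ^ n) / s * (1 / 2) ^ n"
      using a_gt_1 s by (simp add: power_mult_distrib power_divide)
    also have "\<dots> \<le> \<Phi>1 s / s * (1 / 2) ^ n"
      using dilation_power[of s n] s by (intro mult_right_mono divide_right_mono) auto
    also have "\<dots> \<le> \<Phi>1 t / t * (1 / 2) ^ n"
      using \<Phi>1.ratio_le[of s t] s by (intro mult_right_mono) (auto simp: field_simps)
    finally show "\<Phi>1 (level (m - 1 - int n)) / level (m - 1 - int n) \<le> \<Phi>1 t / t * (1 / 2) ^ n"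
      by (simp add: level_diff s_def)
  qed
  also have "\<dots> = ennreal (\<Phi>1 t / t * 2)"
    unfolding nn_integral_count_space_nat by (rule suminf_ennreal_half_powers) (use assms \<Phi>1.pos[OF assms] in auto)
  finally show ?thesis
    by (simp add: mult_ac)
qed

end

text \<open>On the layer between consecutive levels, \<open>\<Phi>2\<close> is at most
  \<open>D ^ m\<close> times its value at the lower level \<open>L\<close>, which cancels the
  \<open>\<Phi>2 L\<close> in the level set estimate. What remains is \<open>\<Phi>1 L / L\<close>
  times the integral of \<open>g\<close> over \<open>g > L\<close>; interchanging sum and integral
  and summing the levels below \<open>g t\<close> gives twice the modular of
  \<open>g\<close>.\<close>

lemma (in hardy_function) embedding:
  assumes "carleson C" "C > 0" and m: "a \<le> 2 ^ m"
  shows "(\<integral>\<^sup>+z\<in>\<complex>\<^sub>+. ennreal (\<Phi>2 (cmod (F z) / 16)) \<partial>\<mu>) \<le> ennreal (2 * D ^ m * C * D ^ 3)"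
proof -
  have "(\<integral>\<^sup>+z\<in>\<complex>\<^sub>+. ennreal (\<Phi>2 (cmod (F z) / 16)) \<partial>\<mu>)
      \<le> (\<integral>\<^sup>+j. ennreal (\<Phi>2 (a * level j)) * emeasure \<mu> {z \<in> \<complex>\<^sub>+. cmod (F z) > 16 * level j} \<partial>count_space UNIV)"
  proof (rule nn_integral_le_cover)
    fix z assume *: "ennreal (\<Phi>2 (cmod (F z) / 16)) * indicator \<complex>\<^sub>+ z > 0"
    define u where "u = cmod (F z) / 16"
    have "z \<in> \<complex>\<^sub>+"
      using * by (cases "z \<in> \<complex>\<^sub>+") auto
    have "u \<noteq> 0"
      using * by (intro notI) (simp add: u_def)
    then have "u > 0"
      by (simp add: u_def)
    \<comment> \<open>This index gives \<open>level j < u \<le> level (j + 1)\<close>: the strict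
      side puts \<open>z\<close> in the level set, the other side bounds
      \<open>\<Phi>2 u\<close>.\<close>
    define j where "j = \<lceil>log a u\<rceil> - 1"
    have "level j < u" "u \<le> level (j + 1)"
      unfolding j_def level_less_iff[OF \<open>u > 0\<close>] le_level_iff[OF \<open>u > 0\<close>] by auto
    moreover have "level (j + 1) = a * level j"
      using level_diff[of "j + 1" 1] a_gt_1 by simp
    ultimately have "\<Phi>2 u \<le> \<Phi>2 (a * level j)" "cmod (F z) > 16 * level j"
      using \<open>u > 0\<close> by (auto intro!: \<Phi>2.mono simp: u_def)
    with \<open>z \<in> \<complex>\<^sub>+\<close> show "\<exists>j\<in>UNIV. z \<in> {z \<in> \<complex>\<^sub>+. cmod (F z) > 16 * level j} \<and>
        ennreal (\<Phi>2 (cmod (F z) / 16)) * indicator \<complex>\<^sub>+ z \<le> ennreal (\<Phi>2 (a * level j))"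
      by (intro bexI[of _ j]) (auto simp: u_def intro!: ennreal_leI)
  qed (auto intro: level_measurable)
  also have "\<dots> \<le> (\<integral>\<^sup>+j. ennreal (D ^ m * C * D ^ 3) * (\<integral>\<^sup>+t. ennreal (\<Phi>1 (level j) / level j) *
      (ennreal (g t) * indicator {level j<..} (g t)) \<partial>lborel) \<partial>count_space UNIV)"
  proof (rule nn_integral_mono)
    fix j
    define l where "l = level j"
    have "l > 0"
      by (simp add: l_def)
    then have [simp]: "\<Phi>1 l > 0" "\<Phi>2 l > 0"
      using \<Phi>1.pos \<Phi>2.pos by auto
    have "\<Phi>2 (a * l) \<le> \<Phi>2 (2 ^ m * l)"
      using m \<open>l > 0\<close> a_gt_1 by (intro \<Phi>2.mono mult_right_mono) auto
    also have "\<dots> \<le> D ^ m * \<Phi>2 l"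
      using \<open>l > 0\<close> by (intro doubling_power) auto
    finally have "ennreal (\<Phi>2 (a * l)) * emeasure \<mu> {z \<in> \<complex>\<^sub>+. cmod (F z) > 16 * l}
      \<le> ennreal (D ^ m * \<Phi>2 l) * (ennreal (C * D ^ 3 * \<Phi>1 l / (l * \<Phi>2 l)) *
          (\<integral>\<^sup>+t. ennreal (g t) * indicator {l<..} (g t) \<partial>lborel))"
      by (intro mult_mono ennreal_leI emeasure_level_le assms \<open>l > 0\<close>) auto
    also have "\<dots> = ennreal (D ^ m * \<Phi>2 l * (C * D ^ 3 * \<Phi>1 l / (l * \<Phi>2 l))) *
          (\<integral>\<^sup>+t. ennreal (g t) * indicator {l<..} (g t) \<partial>lborel)"
      using D_pos \<open>C > 0\<close> \<open>l > 0\<close> \<open>\<Phi>1 l > 0\<close> \<open>\<Phi>2 l > 0\<close> unfolding mult.assoc[symmetric, of "ennreal _"]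
      by (subst ennreal_mult[of "D ^ m * \<Phi>2 l"]) (auto intro!: less_imp_le)
    also have "D ^ m * \<Phi>2 l * (C * D ^ 3 * \<Phi>1 l / (l * \<Phi>2 l)) = D ^ m * C * D ^ 3 * (\<Phi>1 l / l)"
      using less_imp_neq[OF \<open>\<Phi>2 l > 0\<close>] by (simp add: field_simps)
    also have "ennreal \<dots> = ennreal (D ^ m * C * D ^ 3) * ennreal (\<Phi>1 l / l)"
      using D_pos \<open>C > 0\<close> \<open>l > 0\<close> by (intro ennreal_mult) (auto simp: \<Phi>1.nonneg)
    also have "\<dots> * (\<integral>\<^sup>+t. ennreal (g t) * indicator {l<..} (g t) \<partial>lborel)
      = ennreal (D ^ m * C * D ^ 3) * (\<integral>\<^sup>+t. ennreal (\<Phi>1 l / l) * (ennreal (g t) * indicator {l<..} (g t)) \<partial>lborel)"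
      using truncation_measurable[of l] by (subst nn_integral_cmult) (auto simp: mult.assoc)
    finally show "ennreal (\<Phi>2 (a * level j)) * emeasure \<mu> {z \<in> \<complex>\<^sub>+. cmod (F z) > 16 * level j}
      \<le> ennreal (D ^ m * C * D ^ 3) * (\<integral>\<^sup>+t. ennreal (\<Phi>1 (level j) / level j) *
      (ennreal (g t) * indicator {level j<..} (g t)) \<partial>lborel)"
      by (simp add: l_def)
  qed
  also have "\<dots> = ennreal (D ^ m * C * D ^ 3) * (\<integral>\<^sup>+j. (\<integral>\<^sup>+t. ennreal (\<Phi>1 (level j) / level j) *
      (ennreal (g t) * indicator {level j<..} (g t)) \<partial>lborel) \<partial>count_space UNIV)"
    by (rule nn_integral_cmult) simp
  also have "(\<integral>\<^sup>+j. (\<integral>\<^sup>+t. ennreal (\<Phi>1 (level j) / level j) *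
      (ennreal (g t) * indicator {level j<..} (g t)) \<partial>lborel) \<partial>count_space UNIV)
    = (\<integral>\<^sup>+t. (\<integral>\<^sup>+j. ennreal (\<Phi>1 (level j) / level j) *
      (ennreal (g t) * indicator {level j<..} (g t)) \<partial>count_space UNIV) \<partial>lborel)"
    by (rule nn_integral_count_space_nn_integral[symmetric]) auto
  also have "\<dots> \<le> (\<integral>\<^sup>+t. ennreal 2 * ennreal (\<Phi>1 (g t)) \<partial>lborel)"
  proof (rule nn_integral_mono)
    fix t
    show "(\<integral>\<^sup>+j. ennreal (\<Phi>1 (level j) / level j) *
      (ennreal (g t) * indicator {level j<..} (g t)) \<partial>count_space UNIV) \<le> ennreal 2 * ennreal (\<Phi>1 (g t))"
    proof (cases "g t = 0")
      case False
      then have "g t > 0"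
        using g_nonneg[of t] by linarith
      have "(\<integral>\<^sup>+j. ennreal (\<Phi>1 (level j) / level j) * (ennreal (g t) * indicator {level j<..} (g t)) \<partial>count_space UNIV)
        = ennreal (g t) * (\<integral>\<^sup>+j. ennreal (\<Phi>1 (level j) / level j) * indicator {level j<..} (g t) \<partial>count_space UNIV)"
        by (subst nn_integral_cmult[symmetric]) (auto simp: mult_ac)
      also have "\<dots> \<le> ennreal (g t) * ennreal (2 * \<Phi>1 (g t) / g t)"
        by (intro mult_left_mono level_sum_le \<open>g t > 0\<close>) simp
      also have "\<dots> = ennreal (g t * (2 * \<Phi>1 (g t) / g t))"
        using \<Phi>1.pos[OF \<open>g t > 0\<close>] by (intro ennreal_mult[symmetric]) auto
      also have "\<dots> = ennreal 2 * ennreal (\<Phi>1 (g t))"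
        using \<open>g t > 0\<close> \<Phi>1.pos[OF \<open>g t > 0\<close>] by (subst ennreal_mult[symmetric]) auto
      finally show ?thesis .
    qed simp
  qed
  also have "\<dots> = ennreal 2 * (\<integral>\<^sup>+t. ennreal (\<Phi>1 (g t)) \<partial>lborel)"
    by (rule nn_integral_cmult) (use \<Phi>1.measurable_comp[OF g_measurable g_nonneg] in measurable)
  also have "\<dots> \<le> ennreal 2 * 1"
    using le1[of 0] by (intro mult_left_mono) (auto simp: g_def)
  also have "ennreal (D ^ m * C * D ^ 3) * (ennreal 2 * 1) = ennreal (2 * D ^ m * C * D ^ 3)"
    using D_pos \<open>C > 0\<close> by (simp add: ennreal_mult[symmetric] mult_ac del: ennreal_numeral)
  finally show ?thesis
    by (simp add: mult_left_mono)
qed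

section \<open>Luxemburg norms and removal of the upward shift\<close>

lemma lux_norm_nonneg: "lux_norm \<Phi> g \<ge> 0"
  unfolding lux_norm_def by (rule Inf_greatest) auto

lemma hardy_norm_nonneg: "hardy_norm \<Phi> f \<ge> 0"
  unfolding hardy_norm_def by (rule SUP_upper2[of 1]) (auto intro: lux_norm_nonneg)

text \<open>Strict inequality supplies an admissible \<open>k < l\<close> without asking whether the
  infimum is attained; monotonicity of \<open>\<Phi>\<close> does the rest.\<close>

lemma (in convex_growth) nn_integral_le1_of_lux_norm_less:
  assumes "lux_norm \<Phi> h < ereal l"
  shows "(\<integral>\<^sup>+x. ennreal (\<Phi> (cmod (h x) / l)) \<partial>lborel) \<le> 1"
proof -
  obtain k where "k > 0" "k < l" and k: "(\<integral>\<^sup>+x. ennreal (\<Phi> (cmod (h x) / k)) \<partial>lborel) \<le> 1"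
    using assms unfolding lux_norm_def Inf_less_iff by auto
  have "(\<integral>\<^sup>+x. ennreal (\<Phi> (cmod (h x) / l)) \<partial>lborel) \<le> (\<integral>\<^sup>+x. ennreal (\<Phi> (cmod (h x) / k)) \<partial>lborel)"
    using \<open>k > 0\<close> \<open>k < l\<close> by (intro nn_integral_mono ennreal_leI mono divide_left_mono) auto
  with k show ?thesis
    by simp
qed

text \<open>The constant 32 is 16 from the unit ball embedding times 2 from the normalisation. The
  bound for the shifted functions does not depend on the shift, so Fatou's lemma passes to
  \<open>f\<close>.\<close>

lemma (in dilation_measure) carleson_imp_embedding:
  assumes "carleson C" "C > 0" and f: "f \<in> hardy_orlicz \<Phi>1"
  shows "(\<integral>\<^sup>+z\<in>\<complex>\<^sub>+. ennreal (\<Phi>2 (cmod (f z) / (32 * real_of_ereal (hardy_norm \<Phi>1 f)))) \<partial>\<mu>) < \<infinity>"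
proof -
  have hol: "f holomorphic_on \<complex>\<^sub>+" and "hardy_norm \<Phi>1 f < \<infinity>"
    using f by (auto simp: hardy_orlicz_def)
  then obtain N where N: "hardy_norm \<Phi>1 f = ereal N" "N \<ge> 0"
    using hardy_norm_nonneg[of \<Phi>1 f] by (cases "hardy_norm \<Phi>1 f") auto
  show ?thesis
  proof (cases "N = 0")
    case False
    then have "N > 0"
      using N by simp
    obtain m where m: "a < 2 ^ m"
      using real_arch_pow[of 2 a] by auto
    define \<epsilon> where "\<epsilon> n = 1 / real (Suc n)" for n
    \<comment> \<open>Division by \<open>2 * N\<close> instead of \<open>N\<close> keeps the norm
      strictly below the divisor, as needed to extract a modular bound.\<close>
    define F where "F n z = f (z + \<i> * of_real (\<epsilon> n)) / of_real (2 * N)" for n z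
    have \<epsilon>_pos: "\<epsilon> n > 0" for n
      by (simp add: \<epsilon>_def)
    have F_hol: "F n holomorphic_on {w. Im w > - \<epsilon> n}" for n
    proof -
      have "f \<circ> (\<lambda>z. z + \<i> * of_real (\<epsilon> n)) holomorphic_on {w. Im w > - \<epsilon> n}"
        by (intro holomorphic_on_compose_gen[OF _ hol] holomorphic_intros) (auto simp: upper_half_plane_def)
      then show ?thesis
        unfolding F_def using \<open>N > 0\<close> by (intro holomorphic_intros) (auto simp: o_def)
    qed
    have "(\<integral>\<^sup>+x. ennreal (\<Phi>1 (cmod (F n (Complex x y)))) \<partial>lborel) \<le> 1" if "y \<ge> 0" for n y
    proof -
      have "lux_norm \<Phi>1 (\<lambda>x. f (Complex x (y + \<epsilon> n))) \<le> hardy_norm \<Phi>1 f"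
        unfolding hardy_norm_def using \<epsilon>_pos[of n] that by (intro SUP_upper) auto
      also have "\<dots> < ereal (2 * N)"
        using N \<open>N > 0\<close> by simp
      finally have "(\<integral>\<^sup>+x. ennreal (\<Phi>1 (cmod (f (Complex x (y + \<epsilon> n))) / (2 * N))) \<partial>lborel) \<le> 1"
        by (rule \<Phi>1.nn_integral_le1_of_lux_norm_less)
      moreover have "Complex x y + \<i> * of_real (\<epsilon> n) = Complex x (y + \<epsilon> n)" for x
        by (simp add: complex_eq_iff)
      ultimately show ?thesis
        using \<open>N > 0\<close> by (simp add: F_def norm_divide)
    qed
    then have "hardy_function \<Phi>1 \<Phi>2 D \<mu> a (F n) (\<epsilon> n)" for n
      using \<epsilon>_pos F_hol by unfold_locales
    then have bound: "(\<integral>\<^sup>+z\<in>\<complex>\<^sub>+. ennreal (\<Phi>2 (cmod (F n z) / 16)) \<partial>\<mu>) \<le> ennreal (2 * D ^ m * C * D ^ 3)" for n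
      using assms(1,2) m by (intro hardy_function.embedding) auto
    have meas: "(\<lambda>z. ennreal (\<Phi>2 (cmod (F n z) / 16)) * indicator \<complex>\<^sub>+ z) \<in> borel_measurable \<mu>" for n
    proof -
      have "continuous_on \<complex>\<^sub>+ (\<lambda>z. \<Phi>2 (cmod (F n z) / 16))"
        using \<epsilon>_pos[of n]
        by (intro continuous_on_compose2[OF \<Phi>2.continuous] continuous_intros
              continuous_on_subset[OF holomorphic_on_imp_continuous_on[OF F_hol]])
           (auto simp: upper_half_plane_def)
      then have "(\<lambda>z. indicator \<complex>\<^sub>+ z *\<^sub>R \<Phi>2 (cmod (F n z) / 16)) \<in> borel_measurable borel"
        by (intro borel_measurable_continuous_on_indicator) auto
      then have "(\<lambda>z. ennreal (indicator \<complex>\<^sub>+ z *\<^sub>R \<Phi>2 (cmod (F n z) / 16))) \<in> borel_measurable \<mu>"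
        using sets_eq by measurable
      also have "(\<lambda>z. ennreal (indicator \<complex>\<^sub>+ z *\<^sub>R \<Phi>2 (cmod (F n z) / 16)))
          = (\<lambda>z. ennreal (\<Phi>2 (cmod (F n z) / 16)) * indicator \<complex>\<^sub>+ z)"
        by (auto simp: indicator_def)
      finally show ?thesis .
    qed
    have lim: "(\<lambda>n. \<Phi>2 (cmod (F n z) / 16)) \<longlonglongrightarrow> \<Phi>2 (cmod (f z) / (32 * N))" if "z \<in> \<complex>\<^sub>+" for z
    proof -
      have "\<epsilon> \<longlonglongrightarrow> 0"
        unfolding \<epsilon>_def by (rule LIMSEQ_Suc[OF lim_1_over_n])
      then have "(\<lambda>n. z + \<i> * of_real (\<epsilon> n)) \<longlonglongrightarrow> z + \<i> * of_real 0"
        by (intro tendsto_intros)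
      moreover have "isCont f z"
        using holomorphic_on_imp_continuous_on[OF hol] that
        by (subst (asm) continuous_on_eq_continuous_at) (auto simp: upper_half_plane_def open_halfspace_Im_gt)
      ultimately have "(\<lambda>n. f (z + \<i> * of_real (\<epsilon> n))) \<longlonglongrightarrow> f z"
        using isCont_tendsto_compose[of z f "\<lambda>n. z + \<i> * of_real (\<epsilon> n)"] by simp
      then have "(\<lambda>n. cmod (F n z) / 16) \<longlonglongrightarrow> cmod (f z / of_real (2 * N)) / 16"
        unfolding F_def using \<open>N > 0\<close> by (intro tendsto_intros) auto
      then have "(\<lambda>n. \<Phi>2 (cmod (F n z) / 16)) \<longlonglongrightarrow> \<Phi>2 (cmod (f z / of_real (2 * N)) / 16)"
        by (rule continuous_on_tendsto_compose[OF \<Phi>2.continuous]) auto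
      then show ?thesis
        using \<open>N > 0\<close> by (simp add: norm_divide)
    qed
    \<comment> \<open>Pointwise convergence turns the integrand into a lower limit, ready for
      Fatou's lemma.\<close>
    have "(\<integral>\<^sup>+z\<in>\<complex>\<^sub>+. ennreal (\<Phi>2 (cmod (f z) / (32 * N))) \<partial>\<mu>)
        = (\<integral>\<^sup>+z. liminf (\<lambda>n. ennreal (\<Phi>2 (cmod (F n z) / 16)) * indicator \<complex>\<^sub>+ z) \<partial>\<mu>)"
    proof (rule nn_integral_cong)
      fix z
      show "ennreal (\<Phi>2 (cmod (f z) / (32 * N))) * indicator \<complex>\<^sub>+ z
          = liminf (\<lambda>n. ennreal (\<Phi>2 (cmod (F n z) / 16)) * indicator \<complex>\<^sub>+ z)"
        using lim[of z] by (cases "z \<in> \<complex>\<^sub>+") (auto simp: Liminf_const intro!: lim_imp_Liminf[symmetric] tendsto_ennrealI)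
    qed
    also have "\<dots> \<le> liminf (\<lambda>n. \<integral>\<^sup>+z\<in>\<complex>\<^sub>+. ennreal (\<Phi>2 (cmod (F n z) / 16)) \<partial>\<mu>)"
      by (rule nn_integral_liminf[OF meas])
    also have "\<dots> \<le> liminf (\<lambda>n::nat. ennreal (2 * D ^ m * C * D ^ 3))"
      by (intro Liminf_mono always_eventually allI bound)
    also have "\<dots> < \<infinity>"
      by (simp add: Liminf_const)
    finally show ?thesis
      by (simp add: N)
  qed (simp add: N) \<comment> \<open>if the norm is 0, the argument of \<open>\<Phi>2\<close> is a division by zero, hence 0\<close>
qed

section \<open>Test functions\<close>

context convex_growth
begin

text \<open>The finite weights sum to less than 1; the missing weight sits at 0, where
  \<open>\<Phi>\<close> vanishes. Splitting off the first term leaves half of a sum of the same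
  form.\<close>

lemma weighted_sum_le:
  assumes "\<And>i. x i \<ge> 0"
  shows "\<Phi> (\<Sum>i<n. x i / 2 ^ Suc i) \<le> (\<Sum>i<n. \<Phi> (x i) / 2 ^ Suc i)"
  using assms
proof (induction n arbitrary: x)
  case (Suc n)
  define S where "S = (\<Sum>i<n. x (Suc i) / 2 ^ Suc i)"
  have "S \<ge> 0"
    unfolding S_def using Suc.prems by (intro sum_nonneg) auto
  have "(\<Sum>i<Suc n. x i / 2 ^ Suc i) = (1 - 1 / 2) * x 0 + 1 / 2 * S"
    by (simp add: sum.lessThan_Suc_shift S_def sum_distrib_left field_simps del: sum.lessThan_Suc)
  also have "\<Phi> \<dots> \<le> (1 - 1 / 2) * \<Phi> (x 0) + 1 / 2 * \<Phi> S"
    using convex_onD[OF convex, of "1 / 2" "x 0" S] Suc.prems[of 0] \<open>S \<ge> 0\<close> by simp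
  also have "\<dots> \<le> (1 - 1 / 2) * \<Phi> (x 0) + 1 / 2 * (\<Sum>i<n. \<Phi> (x (Suc i)) / 2 ^ Suc i)"
    unfolding S_def using Suc.IH[of "\<lambda>i. x (Suc i)"] Suc.prems by simp
  also have "\<dots> = (\<Sum>i<Suc n. \<Phi> (x i) / 2 ^ Suc i)"
    by (simp add: sum.lessThan_Suc_shift sum_distrib_left field_simps del: sum.lessThan_Suc)
  finally show ?case .
qed simp

lemma weighted_suminf_le:
  assumes nonneg_x: "\<And>i. x i \<ge> 0" and summable: "summable (\<lambda>i. x i / 2 ^ Suc i)"
  shows "ennreal (\<Phi> (\<Sum>i. x i / 2 ^ Suc i)) \<le> (\<Sum>i. ennreal (\<Phi> (x i) / 2 ^ Suc i))"
proof (rule LIMSEQ_le_const2)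
  have "(\<lambda>n. \<Sum>i<n. x i / 2 ^ Suc i) \<longlonglongrightarrow> (\<Sum>i. x i / 2 ^ Suc i)"
    using summable by (rule summable_LIMSEQ)
  then show "(\<lambda>n. ennreal (\<Phi> (\<Sum>i<n. x i / 2 ^ Suc i))) \<longlonglongrightarrow> ennreal (\<Phi> (\<Sum>i. x i / 2 ^ Suc i))"
    using nonneg_x summable
    by (intro tendsto_ennrealI continuous_on_tendsto_compose[OF continuous])
       (auto intro!: sum_nonneg suminf_nonneg always_eventually)
  have "ennreal (\<Phi> (\<Sum>i<n. x i / 2 ^ Suc i)) \<le> (\<Sum>i. ennreal (\<Phi> (x i) / 2 ^ Suc i))" for n
  proof -
    have "ennreal (\<Phi> (\<Sum>i<n. x i / 2 ^ Suc i)) \<le> ennreal (\<Sum>i<n. \<Phi> (x i) / 2 ^ Suc i)"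
      by (intro ennreal_leI weighted_sum_le nonneg_x)
    also have "\<dots> = (\<Sum>i<n. ennreal (\<Phi> (x i) / 2 ^ Suc i))"
      using nonneg_x by (intro sum_ennreal[symmetric]) (simp add: nonneg)
    also have "\<dots> \<le> (\<Sum>i. ennreal (\<Phi> (x i) / 2 ^ Suc i))"
      by (rule sum_le_suminf) auto
    finally show ?thesis .
  qed
  then show "\<exists>N. \<forall>n\<ge>N. ennreal (\<Phi> (\<Sum>i<n. x i / 2 ^ Suc i)) \<le> (\<Sum>i. ennreal (\<Phi> (x i) / 2 ^ Suc i))"
    by blast
qed

text \<open>By convexity, dividing the argument by \<open>M \<ge> 1\<close> divides the modular by
  at least \<open>M\<close>, so \<open>M\<close> is admissible in the Luxemburg norm on each
  line.\<close>

lemma hardy_norm_le: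
  assumes bound: "\<And>y. y > 0 \<Longrightarrow> (\<integral>\<^sup>+x. ennreal (\<Phi> (cmod (f (Complex x y)))) \<partial>lborel) \<le> ennreal M"
    and "M \<ge> 1" and meas: "\<And>y. y > 0 \<Longrightarrow> (\<lambda>x. cmod (f (Complex x y))) \<in> borel_measurable borel"
  shows "hardy_norm \<Phi> f \<le> ereal M"
  unfolding hardy_norm_def
proof (rule SUP_least)
  fix y :: real assume "y \<in> {0<..}"
  then have "y > 0"
    by simp
  note [measurable] = meas[OF this]
  have "(\<integral>\<^sup>+x. ennreal (\<Phi> (cmod (f (Complex x y)) / M)) \<partial>lborel)
      \<le> (\<integral>\<^sup>+x. ennreal (1 / M) * ennreal (\<Phi> (cmod (f (Complex x y)))) \<partial>lborel)"
  proof (rule nn_integral_mono)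
    fix x
    have "\<Phi> (1 / M * cmod (f (Complex x y))) \<le> 1 / M * \<Phi> (cmod (f (Complex x y)))"
      using \<open>M \<ge> 1\<close> by (intro scale_le) auto
    then have "ennreal (\<Phi> (1 / M * cmod (f (Complex x y)))) \<le> ennreal (1 / M * \<Phi> (cmod (f (Complex x y))))"
      by (rule ennreal_leI)
    also have "\<dots> = ennreal (1 / M) * ennreal (\<Phi> (cmod (f (Complex x y))))"
      using \<open>M \<ge> 1\<close> by (intro ennreal_mult nonneg) auto
    finally show "ennreal (\<Phi> (cmod (f (Complex x y)) / M)) \<le> ennreal (1 / M) * ennreal (\<Phi> (cmod (f (Complex x y))))"
      by simp
  qed
  also have "\<dots> = ennreal (1 / M) * (\<integral>\<^sup>+x. ennreal (\<Phi> (cmod (f (Complex x y)))) \<partial>lborel)"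
    by (rule nn_integral_cmult) (use measurable_comp[OF meas[OF \<open>y > 0\<close>]] in simp)
  also have "\<dots> \<le> ennreal (1 / M) * ennreal M"
    by (intro mult_left_mono bound \<open>y > 0\<close>) simp
  also have "\<dots> = 1"
    using \<open>M \<ge> 1\<close> by (subst ennreal_mult[symmetric]) auto
  finally show "lux_norm \<Phi> (\<lambda>x. f (Complex x y)) \<le> ereal M"
    unfolding lux_norm_def using \<open>M \<ge> 1\<close> by (intro Inf_lower) auto
qed

text \<open>A zero norm would make the modular at most 1 for every divisor \<open>l\<close>. On a
  unit segment at height 1 the modulus has a positive minimum \<open>m\<close>, and \<open>l\<close>
  is chosen so that \<open>\<Phi> (m / l) = 2\<close>. Positivity is needed because the norm later
  occurs as a divisor.\<close>

lemma hardy_norm_pos: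
  assumes hol: "f holomorphic_on \<complex>\<^sub>+" and nz: "\<And>z. z \<in> \<complex>\<^sub>+ \<Longrightarrow> f z \<noteq> 0"
  shows "hardy_norm \<Phi> f > 0"
proof (rule ccontr)
  assume "\<not> ?thesis"
  then have "lux_norm \<Phi> (\<lambda>x. f (Complex x 1)) \<le> 0"
    unfolding hardy_norm_def using SUP_upper[of 1 "{0<..}" "\<lambda>y. lux_norm \<Phi> (\<lambda>x. f (Complex x y))"]
    by (auto simp: not_less intro: order_trans)
  then have small: "(\<integral>\<^sup>+x. ennreal (\<Phi> (cmod (f (Complex x 1)) / l)) \<partial>lborel) \<le> 1" if "l > 0" for l
    using that by (intro nn_integral_le1_of_lux_norm_less) (simp add: order_le_less_trans)
  have "continuous_on {0..1} (\<lambda>x. cmod (f (Complex x 1)))"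
    by (intro continuous_on_norm continuous_on_compose2[OF holomorphic_on_imp_continuous_on[OF hol]])
       (auto simp: Complex_eq upper_half_plane_def intro!: continuous_intros)
  then obtain x0 where x0: "x0 \<in> {0..1}" "\<And>x. x \<in> {0..1} \<Longrightarrow> cmod (f (Complex x0 1)) \<le> cmod (f (Complex x 1))"
    using continuous_attains_inf[of "{0..1::real}" "\<lambda>x. cmod (f (Complex x 1))"] by auto
  define m where "m = cmod (f (Complex x0 1))"
  have "m > 0"
    unfolding m_def using nz[of "Complex x0 1"] by (simp add: upper_half_plane_def)
  have "ginv \<Phi> 2 > 0"
    by (simp add: ginv_pos)
  define l where "l = m / ginv \<Phi> 2"
  have "l > 0"
    unfolding l_def using \<open>m > 0\<close> \<open>ginv \<Phi> 2 > 0\<close> by simp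
  have "(\<integral>\<^sup>+x\<in>{0..1::real}. ennreal 2 \<partial>lborel) \<le> (\<integral>\<^sup>+x. ennreal (\<Phi> (cmod (f (Complex x 1)) / l)) \<partial>lborel)"
  proof (rule nn_integral_mono)
    fix x :: real
    show "ennreal 2 * indicator {0..1} x \<le> ennreal (\<Phi> (cmod (f (Complex x 1)) / l))"
    proof (cases "x \<in> {0..1}")
      case True
      have "2 = \<Phi> (m / l)"
        using \<open>m > 0\<close> \<open>ginv \<Phi> 2 > 0\<close> by (simp add: l_def)
      also have "\<dots> \<le> \<Phi> (cmod (f (Complex x 1)) / l)"
        using x0(2)[OF True] \<open>l > 0\<close> \<open>m > 0\<close> by (intro mono divide_right_mono) (auto simp: m_def)
      finally show ?thesis
        using True ennreal_leI[of 2] by simp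
    qed simp
  qed
  also have "\<dots> \<le> 1"
    by (rule small[OF \<open>l > 0\<close>])
  also have "(\<integral>\<^sup>+x\<in>{0..1::real}. ennreal 2 \<partial>lborel) = ennreal 2"
    by (subst nn_integral_cmult_indicator) auto
  finally show False
    by simp
qed

end

section \<open>Superpositions with weights \<open>1 / 2 ^ Suc n\<close>\<close>

lemma horizontal_line_measurable:
  assumes "f holomorphic_on \<complex>\<^sub>+" "y > 0"
  shows "(\<lambda>x. cmod (f (Complex x y))) \<in> borel_measurable borel"
proof (rule borel_measurable_continuous_onI)
  show "continuous_on UNIV (\<lambda>x. cmod (f (Complex x y)))"
    using assms(2)
    by (intro continuous_on_norm continuous_on_compose2[OF holomorphic_on_imp_continuous_on[OF assms(1)]])
       (auto simp: Complex_eq upper_half_plane_def intro!: continuous_intros)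
qed

text \<open>The common majorant \<open>\<beta>\<close> depends on the height alone and decreases
  with it, so its value at the bottom of a disc dominates all terms there. The modular bound
  \<open>M\<close> is uniform in \<open>n\<close>.\<close>

locale bounded_superposition = convex_growth +
  fixes G :: "nat \<Rightarrow> complex \<Rightarrow> complex" and \<beta> :: "real \<Rightarrow> real" and M :: real
  assumes hol: "\<And>n. G n holomorphic_on \<complex>\<^sub>+"
    and bound: "\<And>n z. z \<in> \<complex>\<^sub>+ \<Longrightarrow> cmod (G n z) \<le> \<beta> (Im z)"
    and antimono: "\<And>s t. 0 < s \<Longrightarrow> s \<le> t \<Longrightarrow> \<beta> t \<le> \<beta> s"
    and modular: "\<And>n y. y > 0 \<Longrightarrow> (\<integral>\<^sup>+x. ennreal (\<Phi> (cmod (G n (Complex x y)))) \<partial>lborel) \<le> ennreal M"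
    and M_ge_1: "M \<ge> 1"
begin

definition F :: "complex \<Rightarrow> complex" where "F z = (\<Sum>n. G n z / 2 ^ Suc n)"

lemma summable_half_powers: "summable (\<lambda>n. c / 2 ^ Suc n :: real)"
  using summable_mult[OF summable_geometric[of "1 / 2 :: real"], of "c / 2"] by (simp add: power_divide)

lemma cmod_term: "cmod (G n z / 2 ^ Suc n) = cmod (G n z) / 2 ^ Suc n"
  by (simp only: norm_divide norm_power norm_numeral)

lemma summable_cmod: "z \<in> \<complex>\<^sub>+ \<Longrightarrow> summable (\<lambda>n. cmod (G n z / 2 ^ Suc n))"
  unfolding cmod_term
  by (rule summable_comparison_test'[OF summable_half_powers[of "\<beta> (Im z)"], of 0])
     (auto intro!: divide_right_mono bound)

lemma summable_terms: "z \<in> \<complex>\<^sub>+ \<Longrightarrow> summable (\<lambda>n. G n z / 2 ^ Suc n)"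
  by (rule summable_norm_cancel[OF summable_cmod])

lemma F_holomorphic: "F holomorphic_on \<complex>\<^sub>+"
proof (rule holomorphic_uniform_sequence)
  show "open \<complex>\<^sub>+"
    unfolding upper_half_plane_def by (rule open_halfspace_Im_gt)
  show "(\<lambda>z. \<Sum>n<N. G n z / 2 ^ Suc n) holomorphic_on \<complex>\<^sub>+" for N
    by (intro holomorphic_intros hol) auto
  fix z assume "z \<in> \<complex>\<^sub>+"
  \<comment> \<open>The disc of radius \<open>d\<close> about \<open>z\<close> stays at height at
    least \<open>d\<close>, so \<open>\<beta> d\<close> serves in the Weierstrass M-test.\<close>
  define d where "d = Im z / 2"
  have "d > 0"
    using \<open>z \<in> \<complex>\<^sub>+\<close> by (simp add: d_def upper_half_plane_def)
  have Im: "d \<le> Im w" if "w \<in> cball z d" for w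
  proof -
    have "\<bar>Im (z - w)\<bar> \<le> d"
      using that abs_Im_le_cmod[of "z - w"] by (simp add: dist_norm)
    then show ?thesis
      unfolding d_def abs_le_iff by simp
  qed
  have sub: "cball z d \<subseteq> \<complex>\<^sub>+"
    using Im \<open>d > 0\<close> by (force simp: upper_half_plane_def)
  moreover have "uniform_limit (cball z d) (\<lambda>N w. \<Sum>n<N. G n w / 2 ^ Suc n) F sequentially"
    unfolding F_def
  proof (rule Weierstrass_m_test[OF _ summable_half_powers[of "\<beta> d"]])
    fix n w assume w: "w \<in> cball z d"
    then have "cmod (G n w) \<le> \<beta> d"
      using bound[of w n] antimono[OF \<open>d > 0\<close> Im[OF w]] sub by fastforce
    then show "cmod (G n w / 2 ^ Suc n) \<le> \<beta> d / 2 ^ Suc n"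
      unfolding cmod_term by (rule divide_right_mono) simp
  qed
  ultimately show "\<exists>d>0. cball z d \<subseteq> \<complex>\<^sub>+ \<and> uniform_limit (cball z d) (\<lambda>N w. \<Sum>n<N. G n w / 2 ^ Suc n) F sequentially"
    using \<open>d > 0\<close> by blast
qed

text \<open>Jensen's inequality for weights of total mass 1 preserves the uniform modular
  bound.\<close>

lemma F_modular:
  assumes "y > 0"
  shows "(\<integral>\<^sup>+x. ennreal (\<Phi> (cmod (F (Complex x y)))) \<partial>lborel) \<le> ennreal M"
proof -
  have mem: "Complex x y \<in> \<complex>\<^sub>+" for x
    using assms by (simp add: upper_half_plane_def)
  note [measurable] = horizontal_line_measurable[OF hol assms]
  have "(\<integral>\<^sup>+x. ennreal (\<Phi> (cmod (F (Complex x y)))) \<partial>lborel)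
      \<le> (\<integral>\<^sup>+x. (\<Sum>n. ennreal (1 / 2 ^ Suc n) * ennreal (\<Phi> (cmod (G n (Complex x y))))) \<partial>lborel)"
  proof (rule nn_integral_mono)
    fix x
    have "cmod (F (Complex x y)) \<le> (\<Sum>n. cmod (G n (Complex x y)) / 2 ^ Suc n)"
      unfolding F_def cmod_term[symmetric] by (intro summable_norm summable_cmod mem)
    then have "ennreal (\<Phi> (cmod (F (Complex x y)))) \<le> ennreal (\<Phi> (\<Sum>n. cmod (G n (Complex x y)) / 2 ^ Suc n))"
      by (intro ennreal_leI mono) auto
    also have "\<dots> \<le> (\<Sum>n. ennreal (\<Phi> (cmod (G n (Complex x y))) / 2 ^ Suc n))"
      using summable_cmod[OF mem] unfolding cmod_term by (intro weighted_suminf_le) auto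
    also have "\<dots> = (\<Sum>n. ennreal (1 / 2 ^ Suc n) * ennreal (\<Phi> (cmod (G n (Complex x y)))))"
      by (subst ennreal_mult[symmetric]) (auto simp: nonneg)
    finally show "ennreal (\<Phi> (cmod (F (Complex x y)))) \<le> \<dots>" .
  qed
  also have "\<dots> = (\<Sum>n. ennreal (1 / 2 ^ Suc n) * (\<integral>\<^sup>+x. ennreal (\<Phi> (cmod (G n (Complex x y)))) \<partial>lborel))"
  proof -
    have [measurable]: "(\<lambda>x. ennreal (\<Phi> (cmod (G n (Complex x y))))) \<in> borel_measurable lborel" for n
      using measurable_comp[OF horizontal_line_measurable[OF hol assms]] by simp
    show ?thesis
      by (subst nn_integral_suminf) (auto simp: nn_integral_cmult)
  qed
  also have "\<dots> \<le> (\<Sum>n. ennreal (1 / 2 ^ Suc n) * ennreal M)"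
    by (intro suminf_le mult_left_mono modular assms) auto
  also have "\<dots> = (\<Sum>n. ennreal (M / 2 * (1 / 2) ^ n))"
    using M_ge_1 by (subst ennreal_mult[symmetric]) (auto simp: power_divide)
  also have "\<dots> = ennreal (M / 2 * 2)"
    by (rule suminf_ennreal_half_powers) (use M_ge_1 in auto)
  finally show ?thesis
    by simp
qed

lemma F_hardy: "F \<in> hardy_orlicz \<Phi>"
proof -
  have "hardy_norm \<Phi> F \<le> ereal M"
    using F_modular M_ge_1 horizontal_line_measurable[OF F_holomorphic] by (rule hardy_norm_le)
  also have "\<dots> < \<infinity>"
    by simp
  finally show ?thesis
    using F_holomorphic by (simp add: hardy_orlicz_def)
qed

lemma Re_le_Re_F:
  assumes pos: "\<And>k. Re (G k z) \<ge> 0" and "z \<in> \<complex>\<^sub>+"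
  shows "Re (G n z) / 2 ^ Suc n \<le> Re (F z)"
proof -
  have "(\<lambda>k. Re (G k z / 2 ^ Suc k)) sums Re (F z)"
    unfolding F_def by (intro sums_Re summable_sums summable_terms assms)
  moreover have "Re (G k z / 2 ^ Suc k) = Re (G k z) / 2 ^ Suc k" for k
    using Re_divide_of_real[of "G k z" "2 ^ Suc k"] by simp
  ultimately have s: "(\<lambda>k. Re (G k z) / 2 ^ Suc k) sums Re (F z)"
    by simp
  have "(\<Sum>k\<in>{n}. Re (G k z) / 2 ^ Suc k) \<le> (\<Sum>k. Re (G k z) / 2 ^ Suc k)"
    using s pos by (intro sum_le_suminf) (auto simp: sums_iff)
  then show ?thesis
    using s by (simp add: sums_iff)
qed

end

section \<open>Test functions attached to intervals\<close>

context dilation_measure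
begin

text \<open>The pole lies at distance \<open>l\<close> below \<open>c\<close>, and the factor
  \<open>\<i>\<close> makes the real part positive on the upper half plane. The scaling gives size
  comparable to \<open>ginv \<Phi>1 (1 / l)\<close> on the square over the interval of length
  \<open>l\<close> about \<open>c\<close>.\<close>

definition bump :: "real \<Rightarrow> real \<Rightarrow> complex \<Rightarrow> complex" where
  "bump c l z = of_real (ginv \<Phi>1 (1 / l) * l) * \<i> / (z - of_real c + \<i> * of_real l)"

lemma Re_bump: "Re (bump c l z) = ginv \<Phi>1 (1 / l) * l * (Im z + l) / ((Re z - c)\<^sup>2 + (Im z + l)\<^sup>2)"
  by (simp add: bump_def Re_divide power2_eq_square)

lemma Re_bump_pos: "l > 0 \<Longrightarrow> z \<in> \<complex>\<^sub>+ \<Longrightarrow> Re (bump c l z) > 0"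
  unfolding Re_bump
  by (intro divide_pos_pos mult_pos_pos \<Phi>1.ginv_pos add_nonneg_pos) (auto simp: upper_half_plane_def)

text \<open>The denominator is at most \<open>l\<^sup>2 + (2 * l)\<^sup>2\<close>, which gives the
  5, while \<open>Im z + l\<close> in the numerator is at least \<open>l\<close>.\<close>

lemma Re_bump_ge:
  assumes "l > 0" "\<bar>Re z - c\<bar> \<le> l" "0 < Im z" "Im z < l"
  shows "ginv \<Phi>1 (1 / l) / 5 \<le> Re (bump c l z)"
proof -
  define q where "q = (Re z - c)\<^sup>2 + (Im z + l)\<^sup>2"
  define s where "s = ginv \<Phi>1 (1 / l)"
  have "s > 0"
    unfolding s_def using assms by (intro \<Phi>1.ginv_pos) simp
  have "(Re z - c)\<^sup>2 \<le> l\<^sup>2"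
    using assms by (simp add: abs_le_square_iff[symmetric])
  moreover have "(Im z + l)\<^sup>2 \<le> (2 * l)\<^sup>2"
    using assms by (intro power_mono) auto
  ultimately have "q \<le> 5 * l\<^sup>2"
    unfolding q_def power_mult_distrib by simp
  have "q > 0"
    unfolding q_def using assms by (intro add_nonneg_pos) auto
  have "l * l \<le> l * (Im z + l)"
    using assms by (intro mult_left_mono) auto
  with \<open>q \<le> 5 * l\<^sup>2\<close> have "q \<le> 5 * (l * (Im z + l))"
    by (simp add: power2_eq_square)
  then have "s * q \<le> s * (5 * (l * (Im z + l)))"
    using \<open>s > 0\<close> by (intro mult_left_mono) auto
  then show ?thesis
    unfolding Re_bump q_def[symmetric] s_def[symmetric] using \<open>q > 0\<close> by (simp add: field_simps)
qed

lemma bump_holomorphic: "l > 0 \<Longrightarrow> bump c l holomorphic_on \<complex>\<^sub>+"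
  unfolding bump_def by (intro holomorphic_intros) (auto simp: upper_half_plane_def complex_eq_iff)

lemma cmod_bump: "l > 0 \<Longrightarrow> cmod (bump c l z) = ginv \<Phi>1 (1 / l) * l / cmod (z - of_real c + \<i> * of_real l)"
  by (simp add: bump_def norm_divide norm_mult \<Phi>1.ginv_nonneg)

text \<open>The distance to the pole is at least \<open>Im z + l\<close>, and concavity of the
  inverse absorbs the quotient \<open>l / (Im z + l)\<close>. The bound is independent of
  \<open>c\<close> and \<open>l\<close>, so it can serve as the majorant of the
  superposition.\<close>

lemma cmod_bump_le:
  assumes "l > 0" "z \<in> \<complex>\<^sub>+"
  shows "cmod (bump c l z) \<le> ginv \<Phi>1 (1 / Im z)"
proof -
  have "Im z > 0"
    using assms by (simp add: upper_half_plane_def)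
  have "Im z + l \<le> cmod (z - of_real c + \<i> * of_real l)"
    using abs_Im_le_cmod[of "z - of_real c + \<i> * of_real l"] by simp
  then have "cmod (bump c l z) \<le> ginv \<Phi>1 (1 / l) * l / (Im z + l)"
    unfolding cmod_bump[OF assms(1)] using \<open>Im z > 0\<close> \<open>l > 0\<close>
    by (intro divide_left_mono mult_nonneg_nonneg mult_pos_pos) (auto simp: \<Phi>1.ginv_nonneg)
  also have "\<dots> = l / (Im z + l) * ginv \<Phi>1 (1 / l)"
    by simp
  also have "\<dots> \<le> ginv \<Phi>1 (l / (Im z + l) * (1 / l))"
    using \<open>Im z > 0\<close> \<open>l > 0\<close> by (intro \<Phi>1.scale_ginv_le) auto
  also have "\<dots> \<le> ginv \<Phi>1 (1 / Im z)"
    using \<open>Im z > 0\<close> \<open>l > 0\<close> by (intro \<Phi>1.ginv_mono) (auto simp: field_simps)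
  finally show ?thesis .
qed

text \<open>At distance about \<open>a ^ k * l\<close> from \<open>c\<close> the modulus is at most
  \<open>s / a ^ k\<close>, and the dilation inequality gains \<open>(2 * a) ^ k\<close>. The length
  of the region grows by \<open>a ^ k\<close>, so a factor \<open>2 ^ k\<close> of decay is left and
  the sum is \<open>4 * a\<close>, uniformly in \<open>c\<close>, \<open>l\<close> and
  \<open>y\<close>.\<close>

lemma bump_modular:
  assumes "l > 0" "y > 0"
  shows "(\<integral>\<^sup>+x. ennreal (\<Phi>1 (cmod (bump c l (Complex x y)))) \<partial>lborel) \<le> ennreal (4 * a)"
proof -
  define s where "s = ginv \<Phi>1 (1 / l)"
  have "s > 0" "\<Phi>1 s = 1 / l"
    unfolding s_def using assms by (auto simp: \<Phi>1.ginv_pos)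
  define S where "S k = {c - a ^ Suc k * l<..<c + a ^ Suc k * l}" for k :: nat
  have "(\<integral>\<^sup>+x. ennreal (\<Phi>1 (cmod (bump c l (Complex x y)))) \<partial>lborel)
      \<le> (\<integral>\<^sup>+k. ennreal (1 / ((2 * a) ^ k * l)) * emeasure lborel (S k) \<partial>count_space UNIV)"
  proof (rule nn_integral_le_cover)
    fix x
    obtain k0 where "\<bar>x - c\<bar> / l < a ^ k0"
      using real_arch_pow[OF a_gt_1] by blast
    also have "\<dots> \<le> a ^ Suc k0"
      using a_gt_1 by (intro power_increasing) auto
    finally have ex: "x \<in> S k0"
      using assms by (auto simp: S_def field_simps abs_less_iff)
    define k where "k = (LEAST k. x \<in> S k)"
    have k: "x \<in> S k" and least: "\<And>j. j < k \<Longrightarrow> x \<notin> S j"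
      unfolding k_def using ex by (auto intro: LeastI dest: not_less_Least)
    define w where "w = Complex x y - of_real c + \<i> * of_real l"
    have "\<bar>x - c\<bar> \<le> cmod w" "\<bar>y + l\<bar> \<le> cmod w"
      using abs_Re_le_cmod[of w] abs_Im_le_cmod[of w] by (simp_all add: w_def)
    \<comment> \<open>The interval \<open>S (k - 1)\<close> has radius \<open>a ^ k * l\<close>, so
      minimality gives the first alternative when \<open>k > 0\<close>. For \<open>k = 0\<close> the
      second holds because \<open>y > 0\<close>.\<close>
    moreover have "a ^ k * l \<le> \<bar>x - c\<bar> \<or> a ^ k * l \<le> y + l"
      using least[of "k - 1"] assms by (cases k) (auto simp: S_def abs_if)
    ultimately have w: "a ^ k * l \<le> cmod w"
      by linarith
    have "cmod (bump c l (Complex x y)) = s * l / cmod w"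
      using assms by (simp add: cmod_bump s_def w_def)
    also have "\<dots> \<le> s * l / (a ^ k * l)"
      using w a_gt_1 \<open>s > 0\<close> \<open>l > 0\<close> by (intro frac_le) auto
    also have "\<dots> = s / a ^ k"
      using \<open>l > 0\<close> by simp
    finally have "\<Phi>1 (cmod (bump c l (Complex x y))) \<le> \<Phi>1 (s / a ^ k)"
      by (intro \<Phi>1.mono) auto
    also have "\<dots> \<le> 1 / ((2 * a) ^ k * l)"
      using dilation_power[of s k] \<open>s > 0\<close> \<open>l > 0\<close> a_gt_1 by (simp add: \<open>\<Phi>1 s = 1 / l\<close> field_simps)
    finally show "\<exists>k\<in>UNIV. x \<in> S k \<and> ennreal (\<Phi>1 (cmod (bump c l (Complex x y)))) \<le> ennreal (1 / ((2 * a) ^ k * l))"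
      using k by (auto intro!: ennreal_leI)
  qed (auto simp: S_def)
  also have "\<dots> = (\<integral>\<^sup>+k. ennreal (2 * a * (1 / 2) ^ (k::nat)) \<partial>count_space UNIV)"
  proof (rule nn_integral_cong)
    fix k :: nat
    have "emeasure lborel (S k) = ennreal (2 * (a ^ Suc k * l))"
      unfolding S_def using a_gt_1 \<open>l > 0\<close> by (subst emeasure_lborel_Ioo) auto
    then have "ennreal (1 / ((2 * a) ^ k * l)) * emeasure lborel (S k) = ennreal (1 / ((2 * a) ^ k * l) * (2 * (a ^ Suc k * l)))"
      using a_gt_1 \<open>l > 0\<close> by (simp only:) (subst ennreal_mult, auto)
    also have "1 / ((2 * a) ^ k * l) * (2 * (a ^ Suc k * l)) = 2 * a * (1 / 2) ^ k"
      using a_gt_1 \<open>l > 0\<close> by (simp add: power_mult_distrib power_divide)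
    finally show "ennreal (1 / ((2 * a) ^ k * l)) * emeasure lborel (S k) = ennreal (2 * a * (1 / 2) ^ k)" .
  qed
  also have "\<dots> = ennreal (2 * a * 2)"
    unfolding nn_integral_count_space_nat by (rule suminf_ennreal_half_powers) (use a_gt_1 in auto)
  finally show ?thesis
    by simp
qed

lemma embedding_imp_carleson:
  assumes "K > 0"
    and emb: "\<And>f. f \<in> hardy_orlicz \<Phi>1 \<Longrightarrow> \<exists>z\<in>\<complex>\<^sub>+. f z \<noteq> 0 \<Longrightarrow>
      (\<integral>\<^sup>+z\<in>\<complex>\<^sub>+. ennreal (\<Phi>2 (cmod (f z) / (K * real_of_ereal (hardy_norm \<Phi>1 f)))) \<partial>\<mu>) < \<infinity>"
  shows "\<exists>C>0. carleson C"
proof (rule ccontr)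
  assume "\<not> ?thesis"
  \<comment> \<open>The constants are chosen so that \<open>D ^ Suc n\<close> pays for the weight
    \<open>1 / 2 ^ Suc n\<close> under doubling of \<open>\<Phi>2\<close>, while
    \<open>2 ^ Suc n\<close> remains and is unbounded.\<close>
  then have "\<forall>n. \<not> carleson ((2 * D) ^ Suc n)"
    using D_pos by (metis mult_pos_pos zero_less_numeral zero_less_power)
  then have "\<forall>n. \<exists>u v I. u < v \<and> {u<..<v} \<subseteq> I \<and> I \<subseteq> {u..v} \<and>
      ennreal ((2 * D) ^ Suc n / \<Phi>2 (ginv \<Phi>1 (1 / (v - u)))) < emeasure \<mu> (carleson_square I (v - u))"
    unfolding carleson_def by (meson not_le)
  then obtain u v I where uv: "\<And>n. u n < v n" "\<And>n. {u n<..<v n} \<subseteq> I n" "\<And>n. I n \<subseteq> {u n..v n}"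
    and big: "\<And>n. ennreal ((2 * D) ^ Suc n / \<Phi>2 (ginv \<Phi>1 (1 / (v n - u n)))) < emeasure \<mu> (carleson_square (I n) (v n - u n))"
    by metis
  define l where "l n = v n - u n" for n
  define c where "c n = (u n + v n) / 2" for n
  have l_pos: "l n > 0" for n
    using uv(1)[of n] by (simp add: l_def)
  interpret superposition: bounded_superposition \<Phi>1 "\<lambda>n. bump (c n) (l n)" "\<lambda>t. ginv \<Phi>1 (1 / t)" "4 * a"
  proof unfold_locales
    show "bump (c n) (l n) holomorphic_on \<complex>\<^sub>+" for n
      by (rule bump_holomorphic[OF l_pos])
    show "cmod (bump (c n) (l n) z) \<le> ginv \<Phi>1 (1 / Im z)" if "z \<in> \<complex>\<^sub>+" for n z
      using l_pos that by (rule cmod_bump_le)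
    show "ginv \<Phi>1 (1 / t) \<le> ginv \<Phi>1 (1 / s)" if "0 < s" "s \<le> t" for s t
      using that by (intro \<Phi>1.ginv_mono) (auto simp: field_simps)
    show "(\<integral>\<^sup>+x. ennreal (\<Phi>1 (cmod (bump (c n) (l n) (Complex x y)))) \<partial>lborel) \<le> ennreal (4 * a)" if "y > 0" for n y
      using l_pos that by (rule bump_modular)
    show "4 * a \<ge> 1"
      using a_gt_1 by simp
  qed
  define F where "F = superposition.F"
  have Re_F: "Re (bump (c n) (l n) z) / 2 ^ Suc n \<le> Re (F z)" if "z \<in> \<complex>\<^sub>+" for n z
    unfolding F_def using that Re_bump_pos[OF l_pos that] by (intro superposition.Re_le_Re_F) (auto intro: less_imp_le)
  \<comment> \<open>The real part of \<open>F\<close> is positive, so \<open>F\<close> has no zeros;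
    this makes (c) applicable and its norm positive.\<close>
  have nz: "F z \<noteq> 0" if "z \<in> \<complex>\<^sub>+" for z
  proof -
    have "0 < Re (bump (c 0) (l 0) z) / 2 ^ Suc 0"
      using Re_bump_pos[OF l_pos that] by simp
    with Re_F[OF that, of 0] show ?thesis
      by (metis less_le_not_le order_less_le_trans zero_complex.simps(1))
  qed
  define N where "N = real_of_ereal (hardy_norm \<Phi>1 F)"
  have hardy: "F \<in> hardy_orlicz \<Phi>1"
    unfolding F_def by (rule superposition.F_hardy)
  have "hardy_norm \<Phi>1 F > 0"
    using superposition.F_holomorphic nz unfolding F_def by (intro \<Phi>1.hardy_norm_pos)
  with hardy have "N > 0"
    unfolding N_def by (cases "hardy_norm \<Phi>1 F") (auto simp: hardy_orlicz_def)
  define T where "T = (\<integral>\<^sup>+z\<in>\<complex>\<^sub>+. ennreal (\<Phi>2 (cmod (F z) / (K * N))) \<partial>\<mu>)"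
  have "\<i> \<in> \<complex>\<^sub>+"
    by (simp add: upper_half_plane_def)
  then have "T < \<infinity>"
    unfolding T_def N_def using nz by (intro emb hardy) blast
  \<comment> \<open>The fixed factors, 5 from the lower bound of the test functions and
    \<open>K * N\<close> from (c), are replaced by a power of 2 independent of
    \<open>n\<close>.\<close>
  obtain m where m: "5 * (K * N) < 2 ^ m"
    using real_arch_pow[of 2 "5 * (K * N)"] by auto
  have "ennreal (2 ^ Suc n / D ^ m) \<le> T" for n
  proof -
    define s where "s = ginv \<Phi>1 (1 / l n)"
    have "s > 0" "\<Phi>2 s > 0"
      unfolding s_def using l_pos[of n] by (simp_all add: \<Phi>1.ginv_pos \<Phi>2.pos)
    define Q where "Q = carleson_square (I n) (l n)"
    have [measurable]: "Q \<in> sets \<mu>"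
      using carleson_square_measurable[OF uv(1,2,3)] sets_eq by (simp add: Q_def)
    have lower: "\<Phi>2 s / D ^ (Suc n + m) \<le> \<Phi>2 (cmod (F z) / (K * N))" if "z \<in> Q" for z
    proof -
      have z: "Re z \<in> {u n..v n}" "0 < Im z" "Im z < l n"
        using that uv(3)[of n] by (auto simp: Q_def carleson_square_def)
      then have "\<bar>Re z - c n\<bar> \<le> l n"
        using uv(1)[of n] by (auto simp: c_def l_def abs_if field_simps)
      then have "s / 5 \<le> Re (bump (c n) (l n) z)"
        unfolding s_def using z l_pos by (intro Re_bump_ge) auto
      then have "s / 5 / 2 ^ Suc n \<le> Re (bump (c n) (l n) z) / 2 ^ Suc n"
        by (intro divide_right_mono) auto
      also have "\<dots> \<le> Re (F z)"
        using z by (intro Re_F) (simp add: upper_half_plane_def)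
      also have "\<dots> \<le> cmod (F z)"
        by (rule complex_Re_le_cmod)
      finally have *: "s / 5 / 2 ^ Suc n \<le> cmod (F z)" .
      have "s = 2 ^ Suc n * (5 * (K * N)) * (s / 5 / 2 ^ Suc n / (K * N))"
        using \<open>K > 0\<close> \<open>N > 0\<close> by simp
      also have "\<dots> \<le> 2 ^ Suc n * 2 ^ m * (cmod (F z) / (K * N))"
        using * m \<open>K > 0\<close> \<open>N > 0\<close> \<open>s > 0\<close> by (intro mult_mono divide_right_mono mult_left_mono) auto
      finally have "s \<le> 2 ^ (Suc n + m) * (cmod (F z) / (K * N))"
        by (simp add: power_add)
      then have "\<Phi>2 s \<le> \<Phi>2 (2 ^ (Suc n + m) * (cmod (F z) / (K * N)))"
        using \<open>s > 0\<close> by (intro \<Phi>2.mono) auto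
      also have "\<dots> \<le> D ^ (Suc n + m) * \<Phi>2 (cmod (F z) / (K * N))"
        using \<open>K > 0\<close> \<open>N > 0\<close> by (intro doubling_power) auto
      finally show ?thesis
        using D_pos by (simp add: field_simps)
    qed
    have "2 ^ Suc n / D ^ m = \<Phi>2 s / D ^ (Suc n + m) * ((2 * D) ^ Suc n / \<Phi>2 s)"
      using \<open>\<Phi>2 s > 0\<close> D_pos by (simp add: power_add power_mult_distrib)
    then have "ennreal (2 ^ Suc n / D ^ m) = ennreal (\<Phi>2 s / D ^ (Suc n + m)) * ennreal ((2 * D) ^ Suc n / \<Phi>2 s)"
      using \<open>\<Phi>2 s > 0\<close> D_pos by (simp only:) (intro ennreal_mult; simp)
    also have "\<dots> \<le> ennreal (\<Phi>2 s / D ^ (Suc n + m)) * emeasure \<mu> Q"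
      using big[of n] by (intro mult_left_mono) (auto simp: Q_def l_def s_def)
    also have "\<dots> = (\<integral>\<^sup>+z. ennreal (\<Phi>2 s / D ^ (Suc n + m)) * indicator Q z \<partial>\<mu>)"
      by (subst nn_integral_cmult_indicator) auto
    also have "\<dots> \<le> T"
      unfolding T_def using lower by (intro nn_integral_mono)
        (auto simp: indicator_def upper_half_plane_def Q_def carleson_square_def intro!: ennreal_leI)
    finally show ?thesis .
  qed
  moreover obtain t where "T = ennreal t" "t \<ge> 0"
    using \<open>T < \<infinity>\<close> by (cases T) auto
  ultimately have "2 ^ Suc n / D ^ m \<le> t" for n
    using D_pos by (simp add: ennreal_le_iff)
  then have "2 ^ Suc n \<le> t * D ^ m" for n
    using D_pos by (simp add: divide_le_eq)
  moreover obtain n where "t * D ^ m < 2 ^ n"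
    using real_arch_pow[of 2 "t * D ^ m"] by auto
  ultimately show False
    by (meson less_irrefl less_le_trans order.strict_trans1 power_increasing lessI less_imp_le one_le_numeral)
qed

end

section \<open>The three equivalent conditions\<close>

theorem theorem2p1:
  fixes \<Phi>1 \<Phi>2 :: "real \<Rightarrow> real" and \<mu> :: "complex measure"
  assumes gf1: "growth_function \<Phi>1" and gf2: "growth_function \<Phi>2"
    and C1_1: "C1_on_nonneg \<Phi>1" and C1_2: "C1_on_nonneg \<Phi>2"
    and cvx1: "convex_on {0..} \<Phi>1" and cvx2: "convex_on {0..} \<Phi>2"
    and U2: "\<Phi>2 \<in> class_U"
    and nabla: "Nabla2 \<Phi>1"
    and ratio: "mono_on {0<..} (\<lambda>t. \<Phi>2 t / \<Phi>1 t)"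
    and borel: "sets \<mu> = sets borel"
  shows
   "((\<exists>C>0. \<forall>a b I. a < b \<and> {a<..<b} \<subseteq> I \<and> I \<subseteq> {a..b} \<longrightarrow>
          emeasure \<mu> (carleson_square I (b - a))
            \<le> ennreal (C / \<Phi>2 (ginv \<Phi>1 (1 / (b - a)))))
    \<longleftrightarrow>
    (\<exists>C>0. \<forall>z\<in>\<complex>\<^sub>+.
          (\<integral>\<^sup>+ w\<in>\<complex>\<^sub>+. ennreal (\<Phi>2 (ginv \<Phi>1 (1 / Im z) * (Im z)\<^sup>2 / (cmod (z - cnj w))\<^sup>2)) \<partial>\<mu>)
            \<le> ennreal C))
  \<and>
   ((\<exists>C>0. \<forall>z\<in>\<complex>\<^sub>+.
          (\<integral>\<^sup>+ w\<in>\<complex>\<^sub>+. ennreal (\<Phi>2 (ginv \<Phi>1 (1 / Im z) * (Im z)\<^sup>2 / (cmod (z - cnj w))\<^sup>2)) \<partial>\<mu>)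
            \<le> ennreal C)
    \<longleftrightarrow>
    (\<exists>K>0. \<forall>f\<in>hardy_orlicz \<Phi>1. (\<exists>z\<in>\<complex>\<^sub>+. f z \<noteq> 0) \<longrightarrow>
          (\<integral>\<^sup>+ z\<in>\<complex>\<^sub>+. ennreal (\<Phi>2 (cmod (f z) / (K * real_of_ereal (hardy_norm \<Phi>1 f)))) \<partial>\<mu>)
            < \<infinity>))"
proof -
  obtain q where q: "upper_type q \<Phi>2"
    using U2 by (auto simp: class_U_def class_Uq_def)
  obtain D where D: "D > 0" "\<And>s. s > 0 \<Longrightarrow> \<Phi>2 (2 * s) \<le> D * \<Phi>2 s"
    using upper_type_doubling[OF q] by blast
  \<comment> \<open>Positivity of \<open>\<Phi>1\<close> comes from its own doubling condition,
    contained in \<open>Nabla2\<close>; positivity of \<open>\<Phi>2\<close> comes from its upper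
    type.\<close>
  obtain K where "\<And>t. t \<ge> 0 \<Longrightarrow> \<Phi>1 (2 * t) \<le> K * \<Phi>1 t"
    using nabla by (auto simp: Nabla2_def Delta2_def)
  then have "\<And>t. t > 0 \<Longrightarrow> \<Phi>1 t > 0"
    by (intro doubling_pos[OF gf1, of K]) auto
  then interpret \<Phi>1: convex_growth \<Phi>1
    using gf1 cvx1 by unfold_locales
  interpret \<Phi>2: convex_growth \<Phi>2
    using gf2 cvx2 doubling_pos[OF gf2 D(2)] by unfold_locales
  obtain a where a: "a > 1" "\<And>u. u \<ge> 0 \<Longrightarrow> 2 * a * \<Phi>1 u \<le> \<Phi>1 (a * u)"
    using \<Phi>1.Nabla2_dilation[OF C1_1 nabla] by blast
  interpret dilation_measure \<Phi>1 \<Phi>2 D \<mu> a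
    using D ratio borel a by unfold_locales
  have carleson_iff_testing: "(\<exists>C>0. carleson C) \<longleftrightarrow> (\<exists>C>0. testing C)"
    using testing_imp_carleson carleson_imp_testing by blast
  \<comment> \<open>The equivalence of (b) and (c) is obtained through (a).\<close>
  have "(\<exists>C>0. carleson C) \<longleftrightarrow> (\<exists>K>0. \<forall>f\<in>hardy_orlicz \<Phi>1. (\<exists>z\<in>\<complex>\<^sub>+. f z \<noteq> 0) \<longrightarrow>
      (\<integral>\<^sup>+ z\<in>\<complex>\<^sub>+. ennreal (\<Phi>2 (cmod (f z) / (K * real_of_ereal (hardy_norm \<Phi>1 f)))) \<partial>\<mu>) < \<infinity>)"
    (is "_ \<longleftrightarrow> (\<exists>K>0. ?embedding K)")
  proof
    assume "\<exists>C>0. carleson C"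
    then have "?embedding 32"
      using carleson_imp_embedding by blast
    then show "\<exists>K>0. ?embedding K"
      by (intro exI[of _ 32]) simp
  next
    assume "\<exists>K>0. ?embedding K"
    then show "\<exists>C>0. carleson C"
      using embedding_imp_carleson by blast
  qed
  with carleson_iff_testing show ?thesis
    unfolding carleson_def testing_def kernel_def by simp
qed

end
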